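(* Let $F\in L^1(\mathbb{C})\cap L^\infty(\mathbb{C})$ be a real-valued symbol, not almost everywhere zero, which is radial with respect to a point $a\in\mathbb{C}$. Then the Toeplitz operator $T_F:\mathcal{F}^2(\mathbb{C})\to\mathcal{F}^2(\mathbb{C})$ satisfies $$\|T_F\|\leq \|F\|_\infty\left(1-\exp\left(-\frac{\|F\|_1}{\|F\|_\infty}\right)\right).$$
   Context: $dA$ denotes Lebesgue measure on $\mathbb{C}\cong\mathbb{R}^2$ and $d\lambda(z)=e^{-\pi|z|^2}\,dA(z)$. The Bargmann–Fock space $\mathcal{F}^2(\mathbb{C})$ is the Hilbert space of entire functions $f$ on $\mathbb{C}$ with $\|f\|_{\mathcal{F}}^2=\int_{\mathbb{C}}|f(z)|^2\,d\lambda(z)<+\infty$; it is a closed subspace of $L^2(\mathbb{C},d\lambda)$ with reproducing kernel $K_w(z)=e^{\pi\overline{w}z}$. For a measurable bounded function $F$ on $\mathbb{C}$ (the symbol), the Toeplitz operator $T_F$ on $\mathcal{F}^2(\mathbb{C})$ is $$(T_Ff)(z)=P(Ff)(z)=\int_{\mathbb{C}}F(w)f(w)K_w(z)\,d\lambda(w),$$ where $P$ is the orthogonal projection of $L^2(\mathbb{C},d\lambda)$ onto $\mathcal{F}^2(\mathbb{C})$. $\|T_F\|$ is the operator norm; $\|F\|_1$ and $\|F\|_\infty$ are the norms in $L^1(\mathbb{C},dA)$ and $L^\infty(\mathbb{C},dA)$. The symbol $F$ is radial with respect to $a\in\mathbb{C}$ if $F(z)=g(|z-a|)$ for some bounded measurable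 function $g$ on $[0,+\infty)$. *)

theory Defs
  imports "HOL-Complex_Analysis.Complex_Analysis" "HOL-Probability.Essential_Supremum"
begin

definition gaussian_measure :: "complex measure" where
  "gaussian_measure = density lebesgue (\<lambda>z. ennreal (exp (- pi * (cmod z)\<^sup>2)))"

definition fock_space :: "(complex \<Rightarrow> complex) set" where
  "fock_space = {f. f holomorphic_on UNIV \<and> integrable gaussian_measure (\<lambda>z. (cmod (f z))\<^sup>2)}"

text \<open>Meaningful only for members of \<^const>\<open>fock_space\<close>: on other functions the integral may take
  its default value 0.\<close>

definition fock_norm :: "(complex \<Rightarrow> complex) \<Rightarrow> real" where
  "fock_norm f = sqrt (LINT z|gaussian_measure. (cmod (f z))\<^sup>2)"

definition fock_kernel :: "complex \<Rightarrow> complex \<Rightarrow> complex" where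
  "fock_kernel w z = exp (of_real pi * cnj w * z)"

definition toeplitz :: "(complex \<Rightarrow> complex) \<Rightarrow> (complex \<Rightarrow> complex) \<Rightarrow> complex \<Rightarrow> complex" where
  "toeplitz F f z = (LINT w|gaussian_measure. F w * f w * fock_kernel w z)"

text \<open>The supremum is taken in the extended nonnegative reals, so that an unbounded operator gets
  norm \<^term>\<open>\<infinity> :: ennreal\<close>. It is the operator norm only for linear maps of \<^const>\<open>fock_space\<close>
  into itself.\<close>

definition fock_op_norm :: "((complex \<Rightarrow> complex) \<Rightarrow> complex \<Rightarrow> complex) \<Rightarrow> ennreal" where
  "fock_op_norm T = (SUP f\<in>{f \<in> fock_space. fock_norm f \<le> 1}. ennreal (fock_norm (T f)))"

definition L1_norm :: "(complex \<Rightarrow> real) \<Rightarrow> real" where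
  "L1_norm F = (LINT z|lebesgue. \<bar>F z\<bar>)"

definition Linf_norm :: "(complex \<Rightarrow> real) \<Rightarrow> real" where
  "Linf_norm F = enn2real (esssup lebesgue (\<lambda>z. ennreal \<bar>F z\<bar>))"

text \<open>A symbol stands for its class modulo null sets, hence equality almost everywhere.\<close>

definition radial_about :: "complex \<Rightarrow> (complex \<Rightarrow> real) \<Rightarrow> bool" where
  "radial_about a F \<longleftrightarrow>
     (\<exists>g :: real \<Rightarrow> real. g \<in> borel_measurable (lebesgue_on {0..}) \<and> bounded (g ` {0..}) \<and>
        (AE z in lebesgue. F z = g (cmod (z - a))))"

end

theory Submission
  imports Defs "HOL-Probability.Distributions"
begin

text \<open>Conjugation by the Weyl operator of \<open>a\<close> reduces to symbols radial about 0. Averaging over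
  rotations shows that monomials are then orthogonal eigenvectors of the Toeplitz operator, so that its
  norm is the supremum of the eigenvalues. In the variable \<open>t = pi * (cmod z)\<^sup>2\<close>, which maps area to
  length, the \<open>n\<close>-th eigenvalue is the integral of \<open>F\<close> against the Gamma density
  \<open>t ^ n * exp (- t) / fact n\<close>. By the bathtub principle it is largest when \<open>\<bar>F\<bar>\<close> is its maximum
  \<open>M\<close> times the indicator of an interval of length \<open>s = L / M\<close>. As the hazard rate of the Gamma
  distribution is at most 1, such an interval has mass at most \<open>1 - exp (- s)\<close>.\<close>

subsection \<open>Lebesgue measure on the complex plane\<close>

text \<open>The constant is the eigenvalue for n = 0 when the symbol is M times the indicator of the
  disc of area s about a: there the Gamma law is exponential, with hazard rate exactly 1. The
  difficulty is uniformity in n. For n > 0 the optimal region is an annulus whose position depends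
  on n, and the hazard rate bound makes this position irrelevant. Parseval's identity, which takes
  the place of a Hilbert basis, comes from averaging the squared modulus over rotations and allows
  the value infinity. Applied to the power series of the image, it yields membership in the Fock
  space and the norm bound at once. The symbol is radial only almost everywhere, and the exceptional
  set may depend on the rotation, so the rotated integrand is corrected at each fixed angle before
  the integrals are exchanged. Products and Fubini arguments are carried out with Borel measure and
  a Borel representative of the symbol; the completed measure of the definitions enters only at the
  end.\<close>

lemma lborel_complex_eq_distr:
  "distr (lborel \<Otimes>\<^sub>M lborel) borel (\<lambda>(x, y). Complex x y) = lborel"
proof (rule lborel_eqI[symmetric])
  have m [measurable]: "(\<lambda>(x, y). Complex x y) \<in> lborel \<Otimes>\<^sub>M lborel \<rightarrow>\<^sub>M borel"
    unfolding Complex_eq by measurable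
  fix l u :: complex
  assume le: "\<And>b. b \<in> Basis \<Longrightarrow> l \<bullet> b \<le> u \<bullet> b"
  have le': "Re l \<le> Re u" "Im l \<le> Im u"
    using le[of 1] le[of \<i>] by (auto simp: Basis_complex_def inner_complex_def)
  have "(\<lambda>(x, y). Complex x y) -` box l u \<inter> space (lborel \<Otimes>\<^sub>M lborel)
      = {Re l<..<Re u} \<times> {Im l<..<Im u}"
    by (auto simp: box_def Basis_complex_def inner_complex_def space_pair_measure)
  then have "emeasure (distr (lborel \<Otimes>\<^sub>M lborel) borel (\<lambda>(x, y). Complex x y)) (box l u)
      = emeasure (lborel \<Otimes>\<^sub>M lborel) ({Re l<..<Re u} \<times> {Im l<..<Im u})"
    by (subst emeasure_distr) auto
  also have "\<dots> = ennreal (Re u - Re l) * ennreal (Im u - Im l)"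
    using le' by (subst lborel.emeasure_pair_measure_Times) auto
  also have "\<dots> = (\<Prod>b\<in>Basis. (u - l) \<bullet> b)"
    using le' by (simp add: Basis_complex_def inner_complex_def ennreal_mult')
  finally show "emeasure (distr (lborel \<Otimes>\<^sub>M lborel) borel (\<lambda>(x, y). Complex x y)) (box l u)
      = (\<Prod>b\<in>Basis. (u - l) \<bullet> b)" .
qed simp

lemma nn_integral_lborel_complex:
  fixes h :: "complex \<Rightarrow> ennreal"
  assumes [measurable]: "h \<in> borel_measurable borel"
  shows "(\<integral>\<^sup>+z. h z \<partial>lborel) = (\<integral>\<^sup>+x. \<integral>\<^sup>+y. h (Complex x y) \<partial>lborel \<partial>lborel)"
    and "(\<integral>\<^sup>+z. h z \<partial>lborel) = (\<integral>\<^sup>+y. \<integral>\<^sup>+x. h (Complex x y) \<partial>lborel \<partial>lborel)"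
proof -
  have m [measurable]: "(\<lambda>(x, y). Complex x y) \<in> lborel \<Otimes>\<^sub>M lborel \<rightarrow>\<^sub>M borel"
    unfolding Complex_eq by measurable
  have eq: "(\<integral>\<^sup>+z. h z \<partial>lborel) = (\<integral>\<^sup>+p. h (Complex (fst p) (snd p)) \<partial>(lborel \<Otimes>\<^sub>M lborel))"
    by (subst lborel_complex_eq_distr[symmetric], subst nn_integral_distr)
       (auto simp: case_prod_beta)
  have m2 [measurable]: "(\<lambda>p. h (Complex (fst p) (snd p))) \<in> borel_measurable (lborel \<Otimes>\<^sub>M lborel)"
    unfolding Complex_eq by measurable
  show "(\<integral>\<^sup>+z. h z \<partial>lborel) = (\<integral>\<^sup>+x. \<integral>\<^sup>+y. h (Complex x y) \<partial>lborel \<partial>lborel)"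
    unfolding eq by (subst lborel.nn_integral_fst[symmetric]) auto
  show "(\<integral>\<^sup>+z. h z \<partial>lborel) = (\<integral>\<^sup>+y. \<integral>\<^sup>+x. h (Complex x y) \<partial>lborel \<partial>lborel)"
    unfolding eq by (subst lborel_pair.nn_integral_snd[symmetric]) (auto simp: case_prod_beta)
qed

lemma nn_integral_lborel_shift:
  fixes h :: "real \<Rightarrow> ennreal"
  assumes [measurable]: "h \<in> borel_measurable borel"
  shows "(\<integral>\<^sup>+x. h (x + c) \<partial>lborel) = (\<integral>\<^sup>+x. h x \<partial>lborel)"
  using nn_integral_real_affine[of h 1 c] by (simp add: add.commute)

text \<open>A shear translates each horizontal (or vertical) line by an amount constant on that
  line. Integrating along those lines first reduces the claim to translation invariance on the real
  line.\<close>

lemma nn_integral_complex_shear: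
  fixes h :: "complex \<Rightarrow> ennreal"
  assumes [measurable]: "h \<in> borel_measurable borel"
  shows nn_integral_complex_shear_Re:
      "(\<integral>\<^sup>+z. h (z + of_real (t * Im z)) \<partial>lborel) = (\<integral>\<^sup>+z. h z \<partial>lborel)"
    and nn_integral_complex_shear_Im:
      "(\<integral>\<^sup>+z. h (z + \<i> * of_real (t * Re z)) \<partial>lborel) = (\<integral>\<^sup>+z. h z \<partial>lborel)"
proof -
  have m: "(\<lambda>x. h (Complex x y)) \<in> borel_measurable borel"
    "(\<lambda>y. h (Complex x y)) \<in> borel_measurable borel" for x y
    unfolding Complex_eq by measurable
  have e: "Complex x y + of_real (t * y) = Complex (x + t * y) y"
    "Complex x y + \<i> * of_real (t * x) = Complex x (y + t * x)" for x y
    by (auto simp: complex_eq_iff)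
  have "(\<integral>\<^sup>+z. h (z + of_real (t * Im z)) \<partial>lborel)
      = (\<integral>\<^sup>+y. \<integral>\<^sup>+x. h (Complex (x + t * y) y) \<partial>lborel \<partial>lborel)"
    by (subst nn_integral_lborel_complex(2)) (measurable, simp only: e complex.sel)
  also have "\<dots> = (\<integral>\<^sup>+z. h z \<partial>lborel)"
    using nn_integral_lborel_shift[OF m(1)] by (simp add: nn_integral_lborel_complex(2))
  finally show "(\<integral>\<^sup>+z. h (z + of_real (t * Im z)) \<partial>lborel) = (\<integral>\<^sup>+z. h z \<partial>lborel)" .
  have "(\<integral>\<^sup>+z. h (z + \<i> * of_real (t * Re z)) \<partial>lborel)
      = (\<integral>\<^sup>+x. \<integral>\<^sup>+y. h (Complex x (y + t * x)) \<partial>lborel \<partial>lborel)"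
    by (subst nn_integral_lborel_complex(1)) (measurable, simp only: e complex.sel)
  also have "\<dots> = (\<integral>\<^sup>+z. h z \<partial>lborel)"
    using nn_integral_lborel_shift[OF m(2)] by (simp add: nn_integral_lborel_complex(1))
  finally show "(\<integral>\<^sup>+z. h (z + \<i> * of_real (t * Re z)) \<partial>lborel) = (\<integral>\<^sup>+z. h z \<partial>lborel)" .
qed

text \<open>A rotation other than by \<open>\<pi>\<close> is a product of three shears, and every rotation is the
  square of such a rotation.\<close>

lemma nn_integral_complex_rotate:
  fixes h :: "complex \<Rightarrow> ennreal"
  assumes [measurable]: "h \<in> borel_measurable borel" and u: "cmod u = 1"
  shows "(\<integral>\<^sup>+z. h (u * z) \<partial>lborel) = (\<integral>\<^sup>+z. h z \<partial>lborel)"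
proof -
  have rot: "(\<integral>\<^sup>+z. h (v * z) \<partial>lborel) = (\<integral>\<^sup>+z. h z \<partial>lborel)"
    if [measurable]: "h \<in> borel_measurable borel" and v: "cmod v = 1" "Re v \<noteq> -1"
    for h :: "complex \<Rightarrow> ennreal" and v
  proof -
    \<comment> \<open>Minus the tangent of half the angle of \<open>v\<close>, the parameter for
      which the shears \<open>S\<close>, \<open>R\<close>, \<open>S\<close> compose to the rotation;
      it degenerates only at \<open>v = -1\<close>.\<close>
    define t where "t = - Im v / (1 + Re v)"
    have n0: "1 + Re v \<noteq> 0" using v by auto
    have sq: "Re v * Re v + Im v * Im v = 1"
      using v(1) by (simp add: cmod_def power2_eq_square)
    have c: "1 + t * Im v = Re v" and s: "t * (1 + Re v) = - Im v"
      using n0 sq by (simp_all add: t_def field_simps)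
    define S where "S z = z + of_real (t * Im z)" for z
    define R where "R z = z + \<i> * of_real (Im v * Re z)" for z
    have [measurable]: "S \<in> borel_measurable borel" "R \<in> borel_measurable borel"
      unfolding S_def R_def by measurable
    have "v * z = S (R (S z))" for z
    proof -
      have "Re (S (R (S z))) = (1 + t * Im v) * Re z + t * (1 + (1 + t * Im v)) * Im z"
        "Im (S (R (S z))) = Im v * Re z + (1 + t * Im v) * Im z"
        by (simp_all add: S_def R_def algebra_simps)
      then show ?thesis unfolding c s by (simp add: complex_eq_iff)
    qed
    then have "(\<integral>\<^sup>+z. h (v * z) \<partial>lborel) = (\<integral>\<^sup>+z. h (S (R (S z))) \<partial>lborel)" by simp
    also have "\<dots> = (\<integral>\<^sup>+z. h (S (R z)) \<partial>lborel)"
      using nn_integral_complex_shear_Re[of "\<lambda>z. h (S (R z))" t]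
      by (simp add: S_def[symmetric] del: of_real_mult)
    also have "\<dots> = (\<integral>\<^sup>+z. h (S z) \<partial>lborel)"
      using nn_integral_complex_shear_Im[of "\<lambda>z. h (S z)" "Im v"]
      by (simp add: R_def[symmetric] del: of_real_mult)
    also have "\<dots> = (\<integral>\<^sup>+z. h z \<partial>lborel)"
      using nn_integral_complex_shear_Re[of h t]
      by (simp add: S_def[symmetric] del: of_real_mult)
    finally show ?thesis .
  qed
  \<comment> \<open>The principal root has nonnegative real part, hence is never -1.\<close>
  define v where "v = csqrt u"
  have uv: "u = v * v"
    using power2_csqrt[of u] by (simp add: v_def power2_eq_square)
  have v: "cmod v = 1" "Re v \<noteq> -1"
    using u Re_csqrt[of u] by (auto simp: v_def simp del: Re_csqrt csqrt.sel)
  have "(\<integral>\<^sup>+z. h (u * z) \<partial>lborel) = (\<integral>\<^sup>+z. h (v * z) \<partial>lborel)"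
    using rot[of "\<lambda>z. h (v * z)", OF _ v] by (simp add: uv mult.assoc)
  then show ?thesis using rot[OF _ v, of h] by simp
qed

lemma lborel_distr_rotate:
  assumes "cmod u = 1"
  shows "distr lborel borel (\<lambda>z. u * z) = lborel"
proof (rule measure_eqI)
  fix A assume "A \<in> sets (distr lborel borel (\<lambda>z. u * z))"
  then have [measurable]: "A \<in> sets borel" by simp
  show "emeasure (distr lborel borel (\<lambda>z. u * z)) A = emeasure lborel A"
    using nn_integral_complex_rotate[of "indicator A" u] assms
    by (subst nn_integral_indicator[symmetric], simp, subst nn_integral_distr) auto
qed simp

text \<open>The set where \<open>pi * (cmod z)\<^sup>2 \<le> t\<close> is a disc of area t, and
  half-lines determine a measure on the Borel sets.\<close>

lemma distr_norm_square_complex: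
  "distr lborel borel (\<lambda>z::complex. pi * (cmod z)\<^sup>2) = density lborel (indicator {0..})"
proof (rule measure_eqI_generator_eq)
  let ?E = "range (\<lambda>t::real. {..t})"
  show "Int_stable ?E" by (auto simp: Int_stable_def)
  show "?E \<subseteq> Pow UNIV" by simp
  show "sets (distr lborel borel (\<lambda>z::complex. pi * (cmod z)\<^sup>2)) = sigma_sets UNIV ?E"
    "sets (density lborel (indicator {0..})) = sigma_sets UNIV ?E"
    by (simp_all add: borel_eq_atMost)
  have e1: "emeasure (distr lborel borel (\<lambda>z::complex. pi * (cmod z)\<^sup>2)) {..t} = ennreal t" for t
  proof (cases "t \<ge> 0")
    case True
    have "(\<lambda>z::complex. pi * (cmod z)\<^sup>2) -` {..t} = cball 0 (sqrt (t / pi))"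
    proof -
      have "pi * (cmod z)\<^sup>2 \<le> t \<longleftrightarrow> cmod z \<le> sqrt (t / pi)" for z
        using real_sqrt_le_iff[of "(cmod z)\<^sup>2" "t / pi"] by (simp add: field_simps)
      then show ?thesis by auto
    qed
    then show ?thesis
      using True unit_ball_vol_even[of 1]
      by (simp add: emeasure_distr emeasure_cball)
  next
    case False
    then have "(\<lambda>z::complex. pi * (cmod z)\<^sup>2) -` {..t} = {}"
      by (auto simp: not_le) (smt (verit) pi_gt_zero zero_le_mult_iff zero_le_power2)
    then show ?thesis using False by (simp add: emeasure_distr ennreal_neg)
  qed
  have e2: "emeasure (density lborel (indicator {0..})) {..t} = ennreal t" for t :: real
  proof -
    have "(\<lambda>x::real. indicator {0..} x * indicator {..t} x :: ennreal) = indicator {0..t}"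
      by (auto simp: fun_eq_iff indicator_def)
    then show ?thesis
      by (cases "t \<ge> 0") (auto simp: emeasure_density ennreal_neg)
  qed
  show "emeasure (distr lborel borel (\<lambda>z::complex. pi * (cmod z)\<^sup>2)) X
      = emeasure (density lborel (indicator {0..})) X" if "X \<in> ?E" for X
    using that e1 e2 by auto
  show "range (\<lambda>i. {..real i}) \<subseteq> ?E" by auto
  show "(\<Union>i. {..real i}) = UNIV" by (auto intro: real_arch_simple)
  show "emeasure (distr lborel borel (\<lambda>z::complex. pi * (cmod z)\<^sup>2)) {..real i} \<noteq> \<infinity>" for i
    by (simp add: e1)
qed

subsection \<open>Fourier series on the circle\<close>

lemma borel_measurable_cnj [measurable]: "cnj \<in> borel_measurable borel"
  by (intro borel_measurable_continuous_onI continuous_intros)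

text \<open>Angles are counted in turns, so circle averages are expectations. A density, unlike a
  restriction, keeps the full Borel sigma-algebra.\<close>

definition unit_lborel :: "real measure" where
  "unit_lborel = density lborel (\<lambda>\<theta>. ennreal (indicator {0..1} \<theta>))"

lemma sets_unit_lborel [simp, measurable_cong]: "sets unit_lborel = sets borel"
  by (simp add: unit_lborel_def)

lemma space_unit_lborel [simp]: "space unit_lborel = UNIV"
  by (simp add: unit_lborel_def)

interpretation unit_lborel: prob_space unit_lborel
proof
  show "emeasure unit_lborel (space unit_lborel) = 1"
    by (simp add: unit_lborel_def emeasure_density ennreal_indicator)
qed

definition circ :: "real \<Rightarrow> complex" where
  "circ \<theta> = cis (2 * pi * \<theta>)"

lemma norm_circ [simp]: "cmod (circ \<theta>) = 1"
  by (simp add: circ_def)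

lemma borel_measurable_circ [measurable]: "circ \<in> borel_measurable borel"
  unfolding circ_def by (intro borel_measurable_continuous_onI continuous_intros)

lemma integral_circ_monomial:
  "(\<integral>\<theta>. circ \<theta> ^ k * cnj (circ \<theta>) ^ n \<partial>unit_lborel) = (if k = n then 1 else 0)"
proof (cases "k = n")
  case True
  have "circ \<theta> ^ n * cnj (circ \<theta>) ^ n = 1" for \<theta>
    by (simp add: power_mult_distrib[symmetric] complex_norm_square[symmetric])
  then show ?thesis using True unit_lborel.prob_space by simp
next
  case False
  define c where "c = 2 * pi * (real k - real n)"
  have c0: "c \<noteq> 0" using False by (simp add: c_def)
  have eq: "circ \<theta> ^ k * cnj (circ \<theta>) ^ n = cis (c * \<theta>)" for \<theta>
  proof -
    have "circ \<theta> ^ k * cnj (circ \<theta>) ^ n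
        = cis (real k * (2 * pi * \<theta>)) * cis (real n * - (2 * pi * \<theta>))"
      unfolding circ_def by (simp only: cis_cnj Complex.DeMoivre)
    also have "\<dots> = cis (c * \<theta>)"
      unfolding cis_mult c_def by (rule arg_cong[of _ _ cis]) (simp add: algebra_simps)
    finally show ?thesis .
  qed
  define G where "G \<theta> = cis (c * \<theta>) / (\<i> * of_real c)" for \<theta>
  have der: "(G has_vector_derivative cis (c * \<theta>)) (at \<theta> within {0..1})" for \<theta>
  proof -
    have "((\<lambda>z. exp (\<i> * of_real c * z) / (\<i> * of_real c)) has_field_derivative
        exp (\<i> * of_real c * of_real \<theta>)) (at (of_real \<theta>))"
      using c0 by (auto intro!: derivative_eq_intros)
    from has_vector_derivative_real_field[OF this, of "{0..1}"] show ?thesis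
      by (simp add: G_def[abs_def] cis_conv_exp mult.assoc)
  qed
  have "(\<integral>\<theta>. cis (c * \<theta>) \<partial>unit_lborel) = (\<integral>\<theta>. indicator {0..1} \<theta> *\<^sub>R cis (c * \<theta>) \<partial>lborel)"
    unfolding unit_lborel_def
    by (subst integral_density) (auto intro!: borel_measurable_continuous_onI continuous_intros)
  also have "\<dots> = G 1 - G 0"
    by (rule integral_FTC_Icc) (auto intro!: der continuous_intros)
  \<comment> \<open>The difference of the exponents is an integer, so the antiderivative
    \<open>G\<close> has the same value at both ends.\<close>
  also have "cis c = 1"
    using cis_multiple_2pi[of "real k - real n"] by (simp add: c_def mult.commute)
  then have "G 1 - G 0 = 0" by (simp add: G_def)
  finally show ?thesis using False by (simp add: eq)
qed

context
  fixes b :: "nat \<Rightarrow> complex"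
  assumes b: "summable (\<lambda>k. cmod (b k))"
begin

lemma circle_series_summable: "summable (\<lambda>k. b k * circ \<theta> ^ k)"
  by (rule summable_norm_cancel) (simp add: norm_mult norm_power b)

lemma circle_series_measurable:
  "(\<lambda>\<theta>. \<Sum>k. b k * circ \<theta> ^ k) \<in> borel_measurable borel"
  by measurable

lemma circle_series_bound: "cmod (\<Sum>k. b k * circ \<theta> ^ k) \<le> (\<Sum>k. cmod (b k))"
  using summable_norm[of "\<lambda>k. b k * circ \<theta> ^ k"] by (simp add: norm_mult norm_power b)

text \<open>On the unit circle the terms are bounded by the summable \<open>cmod (b k)\<close>,
  whatever the angle, so sum and integral may be exchanged.\<close>

lemma circle_series_termwise:
  fixes g :: "real \<Rightarrow> complex"
  assumes [measurable]: "g \<in> borel_measurable borel" and g: "\<And>\<theta>. cmod (g \<theta>) \<le> B"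
  shows "(\<lambda>k. b k * (\<integral>\<theta>. circ \<theta> ^ k * g \<theta> \<partial>unit_lborel)) sums
    (\<integral>\<theta>. (\<Sum>k. b k * circ \<theta> ^ k) * g \<theta> \<partial>unit_lborel)"
proof -
  have int: "integrable unit_lborel (\<lambda>\<theta>. b k * (circ \<theta> ^ k * g \<theta>))" for k
    by (intro integrable_mult_right unit_lborel.integrable_const_bound[where B = B])
       (auto simp: norm_mult norm_power g)
  have "(\<lambda>k. \<integral>\<theta>. b k * (circ \<theta> ^ k * g \<theta>) \<partial>unit_lborel) sums
      (\<integral>\<theta>. (\<Sum>k. b k * (circ \<theta> ^ k * g \<theta>)) \<partial>unit_lborel)"
  proof (rule sums_integral[OF int])
    show "AE \<theta> in unit_lborel. summable (\<lambda>k. norm (b k * (circ \<theta> ^ k * g \<theta>)))"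
      by (simp add: norm_mult norm_power summable_mult2 b)
    show "summable (\<lambda>k. \<integral>\<theta>. norm (b k * (circ \<theta> ^ k * g \<theta>)) \<partial>unit_lborel)"
      by (simp add: norm_mult norm_power summable_mult2 b)
  qed
  moreover have "(\<Sum>k. b k * (circ \<theta> ^ k * g \<theta>)) = (\<Sum>k. b k * circ \<theta> ^ k) * g \<theta>" for \<theta>
    using suminf_mult2[OF circle_series_summable, of \<theta> "g \<theta>"] by (simp add: mult.assoc)
  ultimately show ?thesis by simp
qed

lemma circle_series_coeff:
  "(\<integral>\<theta>. (\<Sum>k. b k * circ \<theta> ^ k) * cnj (circ \<theta>) ^ n \<partial>unit_lborel) = b n"
proof -
  have cnj_m: "(\<lambda>\<theta>. cnj (circ \<theta>) ^ n) \<in> borel_measurable borel"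
    by (intro borel_measurable_power measurable_compose[OF borel_measurable_circ]
        borel_measurable_continuous_onI continuous_intros)
  have "(\<lambda>k. b k * (if k = n then 1 else 0)) sums
      (\<integral>\<theta>. (\<Sum>k. b k * circ \<theta> ^ k) * cnj (circ \<theta>) ^ n \<partial>unit_lborel)"
    using circle_series_termwise[of "\<lambda>\<theta>. cnj (circ \<theta>) ^ n" 1, OF cnj_m]
    by (simp add: integral_circ_monomial norm_power)
  moreover have "(\<lambda>k. b k * (if k = n then 1 else 0)) sums b n"
    using sums_single[of n b] by (simp add: if_distrib cong: if_cong)
  ultimately show ?thesis using sums_unique2 by blast
qed

text \<open>Termwise integration against the conjugate of the sum itself: each integral is then a
  conjugated Fourier coefficient. The extended nonnegative form prepares for Tonelli's
  theorem.\<close>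

lemma circle_series_parseval:
  "(\<integral>\<^sup>+\<theta>. ennreal ((cmod (\<Sum>k. b k * circ \<theta> ^ k))\<^sup>2) \<partial>unit_lborel)
    = (\<Sum>k. ennreal ((cmod (b k))\<^sup>2))"
proof -
  define g where "g \<theta> = (\<Sum>k. b k * circ \<theta> ^ k)" for \<theta>
  have [measurable]: "g \<in> borel_measurable borel"
    unfolding g_def by (rule circle_series_measurable)
  have cnj_m: "(\<lambda>\<theta>. cnj (g \<theta>)) \<in> borel_measurable borel"
    by (rule measurable_compose[OF \<open>g \<in> borel_measurable borel\<close>])
       (intro borel_measurable_continuous_onI continuous_intros)
  have gB: "cmod (g \<theta>) \<le> (\<Sum>k. cmod (b k))" for \<theta>
    unfolding g_def by (rule circle_series_bound)
  have "(\<integral>\<theta>. circ \<theta> ^ k * cnj (g \<theta>) \<partial>unit_lborel) = cnj (b k)" for k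
  proof -
    have "(\<integral>\<theta>. circ \<theta> ^ k * cnj (g \<theta>) \<partial>unit_lborel)
        = (\<integral>\<theta>. cnj (g \<theta> * cnj (circ \<theta>) ^ k) \<partial>unit_lborel)"
      by (simp add: mult.commute)
    also have "\<dots> = cnj (\<integral>\<theta>. g \<theta> * cnj (circ \<theta>) ^ k \<partial>unit_lborel)"
      by (rule Bochner_Integration.integral_cnj)
    finally show ?thesis using circle_series_coeff by (simp add: g_def)
  qed
  then have "(\<lambda>k. b k * cnj (b k)) sums (\<integral>\<theta>. g \<theta> * cnj (g \<theta>) \<partial>unit_lborel)"
    using circle_series_termwise[OF cnj_m, of "\<Sum>k. cmod (b k)"] gB
    by (simp add: g_def[symmetric])
  then have "(\<lambda>k. of_real ((cmod (b k))\<^sup>2) :: complex) sums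
      of_real (\<integral>\<theta>. (cmod (g \<theta>))\<^sup>2 \<partial>unit_lborel)"
    by (simp only: complex_norm_square[symmetric] integral_complex_of_real)
  then have s: "(\<lambda>k. (cmod (b k))\<^sup>2) sums (\<integral>\<theta>. (cmod (g \<theta>))\<^sup>2 \<partial>unit_lborel)"
    by (simp only: sums_of_real_iff)
  have "integrable unit_lborel (\<lambda>\<theta>. (cmod (g \<theta>))\<^sup>2)"
    by (rule unit_lborel.integrable_const_bound[where B = "(\<Sum>k. cmod (b k))\<^sup>2"])
       (auto intro!: power_mono gB)
  then have "(\<integral>\<^sup>+\<theta>. ennreal ((cmod (g \<theta>))\<^sup>2) \<partial>unit_lborel)
      = ennreal (\<integral>\<theta>. (cmod (g \<theta>))\<^sup>2 \<partial>unit_lborel)"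
    by (intro nn_integral_eq_integral) auto
  also have "\<dots> = (\<Sum>k. ennreal ((cmod (b k))\<^sup>2))"
    using s by (intro suminf_ennreal_eq[symmetric]) auto
  finally show ?thesis by (simp add: g_def)
qed

end

subsection \<open>Gamma densities\<close>

definition gamma_dens :: "nat \<Rightarrow> real \<Rightarrow> real" where
  "gamma_dens n t = t ^ n * exp (- t) / fact n"

lemma borel_measurable_gamma_dens [measurable]: "gamma_dens n \<in> borel_measurable borel"
  unfolding gamma_dens_def by measurable

lemma gamma_dens_nonneg: "0 \<le> t \<Longrightarrow> 0 \<le> gamma_dens n t"
  by (simp add: gamma_dens_def)

text \<open>At n = 0 the exponent \<open>n - 1\<close> is truncated to 0, harmlessly, since the
  factor \<open>real n\<close> vanishes.\<close>

lemma gamma_dens_has_derivative: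
  "(gamma_dens n has_real_derivative
     exp (- t) * (real n * t ^ (n - 1) - t ^ n) / fact n) (at t)"
  unfolding gamma_dens_def by (auto intro!: derivative_eq_intros simp: field_simps)

text \<open>For n > 0 the derivative is a nonnegative multiple of n - t on the half-line, so the
  density is unimodal with mode n.\<close>

lemma gamma_dens_mono:
  assumes "0 \<le> x" "x \<le> y" "y \<le> real n"
  shows "gamma_dens n x \<le> gamma_dens n y"
proof (cases n)
  case (Suc m)
  show ?thesis
  proof (rule DERIV_nonneg_imp_nondecreasing[OF assms(2)])
    fix t assume "x \<le> t" "t \<le> y"
    then have t: "0 \<le> t" "t \<le> real n" using assms by auto
    have "t ^ n \<le> real n * t ^ (n - 1)"
      using t Suc by (simp add: mult_right_mono)
    then show "\<exists>d. (gamma_dens n has_real_derivative d) (at t) \<and> 0 \<le> d"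
      using gamma_dens_has_derivative by fastforce
  qed
next
  case 0
  then have "x = y" using assms by simp
  then show ?thesis by simp
qed

lemma gamma_dens_antimono:
  assumes "real n \<le> x" "x \<le> y"
  shows "gamma_dens n y \<le> gamma_dens n x"
proof (rule DERIV_nonpos_imp_nonincreasing[OF assms(2)])
  fix t assume "x \<le> t" "t \<le> y"
  then have t: "0 \<le> t" "real n \<le> t" using assms by auto
  have "real n * t ^ (n - 1) \<le> t ^ n"
    using t by (cases n) (auto simp: mult_right_mono)
  then have "exp (- t) * (real n * t ^ (n - 1) - t ^ n) / fact n \<le> 0"
    by (simp add: divide_nonpos_pos mult_nonneg_nonpos)
  then show "\<exists>d. (gamma_dens n has_real_derivative d) (at t) \<and> d \<le> 0"
    using gamma_dens_has_derivative by blast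
qed

text \<open>Supplies the superlevel set for the bathtub principle. A window of length s around the
  mode with equal densities at its two ends is such a set, and the common end value is the level
  c.\<close>

lemma gamma_dens_window:
  assumes s: "s > 0"
  obtains \<alpha> c where "0 \<le> \<alpha>" "0 \<le> c"
    "\<And>t. t \<in> {\<alpha>..\<alpha> + s} \<Longrightarrow> c \<le> gamma_dens n t"
    "\<And>t. 0 \<le> t \<Longrightarrow> t \<notin> {\<alpha>..\<alpha> + s} \<Longrightarrow> gamma_dens n t \<le> c"
proof (cases n)
  case 0
  \<comment> \<open>For n = 0 the density decreases from 0 on, so the ends cannot be balanced: the
    window starts at 0 and the level is the value at its right end.\<close>
  show ?thesis
    by (rule that[of 0 "exp (- s)"]) (auto simp: 0 gamma_dens_def)
next
  case (Suc m)
  \<comment> \<open>The leftmost nonnegative start for which the window still reaches the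
    mode.\<close>
  define a where "a = max 0 (real n - s)"
  define \<phi> where "\<phi> x = gamma_dens n (x + s) - gamma_dens n x" for x
  have "\<phi> (real n) \<le> 0"
    using s by (simp add: \<phi>_def gamma_dens_antimono)
  moreover have "0 \<le> \<phi> a"
  proof (cases "s \<le> real n")
    case True
    then show ?thesis using s by (simp add: \<phi>_def a_def gamma_dens_mono)
  next
    \<comment> \<open>The start is cut off at 0, where the density vanishes because n > 0.\<close>
    case False
    then have "a = 0" by (simp add: a_def)
    then show ?thesis using s Suc gamma_dens_nonneg[of s n] by (simp add: \<phi>_def gamma_dens_def)
  qed
  moreover have "continuous_on {a..real n} \<phi>"
    unfolding \<phi>_def gamma_dens_def by (intro continuous_intros) auto
  moreover have "a \<le> real n" using s by (simp add: a_def)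
  ultimately obtain \<alpha> where \<alpha>: "a \<le> \<alpha>" "\<alpha> \<le> real n" "\<phi> \<alpha> = 0"
    using IVT2'[of \<phi> "real n" 0 a] by blast
  have \<alpha>': "0 \<le> \<alpha>" "real n \<le> \<alpha> + s" using \<alpha>(1) by (auto simp: a_def)
  have eq: "gamma_dens n (\<alpha> + s) = gamma_dens n \<alpha>" using \<alpha>(3) by (simp add: \<phi>_def)
  show ?thesis
  proof (rule that[of \<alpha> "gamma_dens n \<alpha>"])
    show "gamma_dens n \<alpha> \<le> gamma_dens n t" if "t \<in> {\<alpha>..\<alpha> + s}" for t
    proof (cases "t \<le> real n")
      case True
      then show ?thesis using that \<alpha>' by (intro gamma_dens_mono) auto
    next
      case False
      then have "gamma_dens n (\<alpha> + s) \<le> gamma_dens n t"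
        using that by (intro gamma_dens_antimono) auto
      then show ?thesis by (simp add: eq)
    qed
    show "gamma_dens n t \<le> gamma_dens n \<alpha>" if "0 \<le> t" "t \<notin> {\<alpha>..\<alpha> + s}" for t
    proof (cases "t < \<alpha>")
      case True
      then show ?thesis using that \<alpha> by (intro gamma_dens_mono) auto
    next
      case False
      then have "gamma_dens n t \<le> gamma_dens n (\<alpha> + s)"
        using that \<alpha>' by (intro gamma_dens_antimono) auto
      then show ?thesis by (simp add: eq)
    qed
  qed (use \<alpha>' gamma_dens_nonneg in auto)
qed

text \<open>The mass of the Gamma distribution beyond t, written as the Poisson probability of at
  most n events.\<close>

definition gamma_tail :: "nat \<Rightarrow> real \<Rightarrow> real" where
  "gamma_tail n t = exp (- t) * (\<Sum>j\<le>n. t ^ j / fact j)"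

text \<open>The derivatives telescope: raising n adds \<open>gamma_dens (Suc n)\<close>, whose
  derivative is \<open>gamma_dens n - gamma_dens (Suc n)\<close>.\<close>

lemma gamma_tail_has_derivative:
  "(gamma_tail n has_real_derivative - gamma_dens n t) (at t)"
proof (induction n)
  case 0
  then show ?case
    unfolding gamma_tail_def gamma_dens_def by (auto intro!: derivative_eq_intros)
next
  case (Suc n)
  have eq: "gamma_tail (Suc n) = (\<lambda>t. gamma_tail n t + gamma_dens (Suc n) t)"
    by (auto simp: gamma_tail_def gamma_dens_def algebra_simps)
  have "exp (- t) * (real (Suc n) * t ^ n - t ^ Suc n) / fact (Suc n)
      = gamma_dens n t - gamma_dens (Suc n) t"
  proof -
    have "exp (- t) * (real (Suc n) * t ^ n - t ^ Suc n) / fact (Suc n)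
        = exp (- t) * t ^ n * (real (Suc n) / fact (Suc n)) - gamma_dens (Suc n) t"
      by (simp only: gamma_dens_def right_diff_distrib diff_divide_distrib
          times_divide_eq_right mult.commute mult.left_commute)
    also have "real (Suc n) / fact (Suc n) = 1 / fact n"
      using nonzero_mult_divide_mult_cancel_left[of "real (Suc n)" 1 "fact n"]
      unfolding fact_Suc of_nat_mult by simp
    finally show ?thesis
      by (simp add: gamma_dens_def mult.commute del: fact_Suc of_nat_Suc power_Suc)
  qed
  with DERIV_add[OF Suc.IH gamma_dens_has_derivative[of "Suc n" t]]
  show ?case unfolding eq by simp
qed

text \<open>The hazard rate of the Gamma distribution is at most 1, so an interval of length \<open>s\<close>
  carries at most the mass \<open>1 - exp (- s)\<close> of the exponential distribution.\<close>

lemma gamma_tail_diff_le: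
  assumes "0 \<le> \<alpha>" "0 \<le> s"
  shows "gamma_tail n \<alpha> - gamma_tail n (\<alpha> + s) \<le> 1 - exp (- s)"
proof -
  define p where "p t = (\<Sum>j\<le>n. t ^ j / fact j)" for t :: real
  have p0: "0 \<le> p \<alpha>" unfolding p_def using assms by (intro sum_nonneg) auto
  have pm: "p \<alpha> \<le> p (\<alpha> + s)" unfolding p_def
    using assms by (intro sum_mono divide_right_mono power_mono) auto
  have "p \<alpha> \<le> exp \<alpha>"
  proof -
    have "(\<lambda>j. \<alpha> ^ j / fact j) sums exp \<alpha>"
      using exp_converges[of \<alpha>] by (simp add: divide_inverse mult.commute)
    then show ?thesis
      unfolding p_def using assms
      by (metis (no_types, lifting) sums_unique sum_le_suminf sums_summable finite_atMost
          divide_nonneg_pos zero_le_power fact_gt_zero)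
  qed
  then have S1: "gamma_tail n \<alpha> \<le> 1"
    unfolding gamma_tail_def p_def[symmetric]
    using mult_left_mono[of "p \<alpha>" "exp \<alpha>" "exp (- \<alpha>)"] by (simp add: exp_minus)
  \<comment> \<open>The hazard rate bound in integrated form: the polynomial factor \<open>p\<close>
    increases, so the tail decays no faster than the exponential one.\<close>
  have "exp (- s) * gamma_tail n \<alpha> \<le> gamma_tail n (\<alpha> + s)"
    using mult_left_mono[OF pm, of "exp (- (\<alpha> + s))"]
    unfolding gamma_tail_def p_def[symmetric]
    by (simp add: exp_add[of "- \<alpha>" "- s", simplified] mult_ac)
  moreover have "gamma_tail n \<alpha> * (1 - exp (- s)) \<le> 1 * (1 - exp (- s))"
    using S1 assms by (intro mult_right_mono) auto
  ultimately show ?thesis by (simp add: algebra_simps)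
qed

section \<open>Radial integrals and the bathtub bound\<close>

lemma nn_integral_norm_square_complex:
  fixes h :: "real \<Rightarrow> ennreal"
  assumes [measurable]: "h \<in> borel_measurable borel"
  shows "(\<integral>\<^sup>+z. h (pi * (cmod z)\<^sup>2) \<partial>lborel) = (\<integral>\<^sup>+t. h t * indicator {0..} t \<partial>lborel)"
proof -
  have "(\<integral>\<^sup>+z. h (pi * (cmod z)\<^sup>2) \<partial>lborel)
      = (\<integral>\<^sup>+t. h t \<partial>distr lborel borel (\<lambda>z::complex. pi * (cmod z)\<^sup>2))"
    by (subst nn_integral_distr) auto
  also have "\<dots> = (\<integral>\<^sup>+t. indicator {0..} t * h t \<partial>lborel)"
    by (simp add: distr_norm_square_complex nn_integral_density)
  finally show ?thesis by (simp add: mult.commute)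
qed

text \<open>Combined with \<open>gauss_monomial\<close>, this gives the n-th monomial the squared
  norm \<open>fact n / pi ^ n\<close>.\<close>

lemma nn_integral_gamma_dens:
  "(\<integral>\<^sup>+z. ennreal (gamma_dens n (pi * (cmod z)\<^sup>2)) \<partial>lborel) = 1"
proof -
  have "(\<integral>\<^sup>+z. ennreal (gamma_dens n (pi * (cmod z)\<^sup>2)) \<partial>lborel)
      = (\<integral>\<^sup>+t. ennreal (gamma_dens n t) * indicator {0..} t \<partial>lborel)"
    by (rule nn_integral_norm_square_complex) simp
  also have "\<dots> = (\<integral>\<^sup>+t. ennreal (1 / fact n) * (ennreal (t ^ n * exp (- t)) * indicator {0..} t) \<partial>lborel)"
    by (intro nn_integral_cong)
       (auto simp: gamma_dens_def indicator_def ennreal_mult'[symmetric])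
  also have "\<dots> = ennreal (1 / fact n) * (\<integral>\<^sup>+t. ennreal (t ^ n * exp (- t)) * indicator {0..} t \<partial>lborel)"
    by (rule nn_integral_cmult) simp
  also have "\<dots> = ennreal (1 / fact n) * ennreal (fact n)"
    by (subst nn_intergal_power_times_exp_Ici) simp
  also have "\<dots> = 1"
    by (simp add: ennreal_mult'[symmetric])
  finally show ?thesis .
qed

text \<open>With I the window at level c, the product of
  \<open>M * indicator I - \<bar>F\<bar>\<close> and \<open>gamma_dens n - c\<close> is nonnegative
  almost everywhere. On integration the terms in c cancel, because the window has length L / M and
  so both candidates have total mass L.\<close>

lemma nn_integral_gamma_dens_le:
  fixes F :: "complex \<Rightarrow> real"
  assumes [measurable]: "F \<in> borel_measurable borel"
    and bound: "AE z in lborel. \<bar>F z\<bar> \<le> M" and M: "0 < M"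
    and L: "(\<integral>\<^sup>+z. ennreal \<bar>F z\<bar> \<partial>lborel) = ennreal L" and L0: "0 < L"
  shows "(\<integral>\<^sup>+z. ennreal (\<bar>F z\<bar> * gamma_dens n (pi * (cmod z)\<^sup>2)) \<partial>lborel)
    \<le> ennreal (M * (1 - exp (- (L / M))))"
proof -
  define s where "s = L / M"
  have s: "s > 0" using M L0 by (simp add: s_def)
  obtain \<alpha> c where \<alpha>: "0 \<le> \<alpha>" and c: "0 \<le> c"
    and inside: "\<And>t. t \<in> {\<alpha>..\<alpha> + s} \<Longrightarrow> c \<le> gamma_dens n t"
    and outside: "\<And>t. 0 \<le> t \<Longrightarrow> t \<notin> {\<alpha>..\<alpha> + s} \<Longrightarrow> gamma_dens n t \<le> c"
    using gamma_dens_window[OF s, of n] by blast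
  define q where "q z = pi * (cmod z)\<^sup>2" for z :: complex
  have [measurable]: "q \<in> borel_measurable borel" unfolding q_def by measurable
  have q0: "0 \<le> q z" for z by (simp add: q_def)
  define I where "I = {\<alpha>..\<alpha> + s}"
  have [measurable]: "I \<in> sets borel" by (simp add: I_def)
  have I0: "indicator I t * indicator {0..} t = (indicator I t :: ennreal)" for t
    using \<alpha> by (auto simp: I_def indicator_def)
  have area: "(\<integral>\<^sup>+z. indicator I (q z) \<partial>lborel) = ennreal s"
    unfolding q_def
    by (subst nn_integral_norm_square_complex) (simp_all add: I0, simp add: I_def s less_imp_le)
  have mass: "(\<integral>\<^sup>+z. ennreal (gamma_dens n (q z)) * indicator I (q z) \<partial>lborel)
      \<le> ennreal (1 - exp (- s))"
  proof -
    have "(\<integral>\<^sup>+z. ennreal (gamma_dens n (q z)) * indicator I (q z) \<partial>lborel)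
        = (\<integral>\<^sup>+t. ennreal (gamma_dens n t) * indicator I t \<partial>lborel)"
      unfolding q_def
      by (subst nn_integral_norm_square_complex[of "\<lambda>t. ennreal (gamma_dens n t) * indicator I t"])
         (simp_all add: mult.assoc I0)
    also have "\<dots> = ennreal (- gamma_tail n (\<alpha> + s) - (- gamma_tail n \<alpha>))"
      unfolding I_def
    proof (rule nn_integral_FTC_Icc)
      fix t assume "t \<in> {\<alpha>..\<alpha> + s}"
      then show "0 \<le> gamma_dens n t" using \<alpha> by (simp add: gamma_dens_nonneg)
      show "((\<lambda>t. - gamma_tail n t) has_real_derivative gamma_dens n t) (at t)"
        using DERIV_minus[OF gamma_tail_has_derivative[of n t]] by simp
    qed (use s in auto)
    also have "\<dots> \<le> ennreal (1 - exp (- s))"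
      using gamma_tail_diff_le[OF \<alpha>, of s n] s by (intro ennreal_leI) simp
    finally show ?thesis .
  qed
  let ?X = "\<integral>\<^sup>+z. ennreal (\<bar>F z\<bar> * gamma_dens n (q z)) \<partial>lborel"
  \<comment> \<open>Adding \<open>L * c\<close> to both sides avoids subtraction of extended
    nonnegative numbers; it equals M * c times the area of the annulus.\<close>
  have "?X + ennreal (L * c) = ?X + ennreal (M * c) * (\<integral>\<^sup>+z. indicator I (q z) \<partial>lborel)"
    using M c s by (simp add: area ennreal_mult'[symmetric] s_def mult.commute)
  also have "\<dots> = (\<integral>\<^sup>+z. ennreal (\<bar>F z\<bar> * gamma_dens n (q z)) + ennreal (M * c) * indicator I (q z) \<partial>lborel)"
    by (subst nn_integral_add) (auto simp: nn_integral_cmult)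
  also have "\<dots> \<le> (\<integral>\<^sup>+z. ennreal c * ennreal \<bar>F z\<bar>
      + ennreal M * (ennreal (gamma_dens n (q z)) * indicator I (q z)) \<partial>lborel)"
  proof (rule nn_integral_mono_AE)
    show "AE z in lborel. ennreal (\<bar>F z\<bar> * gamma_dens n (q z)) + ennreal (M * c) * indicator I (q z)
        \<le> ennreal c * ennreal \<bar>F z\<bar> + ennreal M * (ennreal (gamma_dens n (q z)) * indicator I (q z))"
      using bound
    proof eventually_elim
      case (elim z)
      have g0: "0 \<le> gamma_dens n (q z)" by (rule gamma_dens_nonneg[OF q0])
      show ?case
      proof (cases "q z \<in> I")
        case True
        then have "(M - \<bar>F z\<bar>) * c \<le> (M - \<bar>F z\<bar>) * gamma_dens n (q z)"
          using elim inside by (intro mult_left_mono) (auto simp: I_def)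
        then have "\<bar>F z\<bar> * gamma_dens n (q z) + M * c \<le> c * \<bar>F z\<bar> + M * gamma_dens n (q z)"
          by (simp add: algebra_simps)
        then show ?thesis using True M c g0
          by (simp add: ennreal_mult[symmetric] ennreal_plus[symmetric] del: ennreal_plus)
      next
        case False
        then have "\<bar>F z\<bar> * gamma_dens n (q z) \<le> \<bar>F z\<bar> * c"
          using outside q0 by (intro mult_left_mono) (auto simp: I_def)
        then show ?thesis using False c
          by (simp add: ennreal_mult[symmetric] ennreal_leI mult.commute)
      qed
    qed
  qed
  also have "\<dots> = ennreal c * ennreal L
      + ennreal M * (\<integral>\<^sup>+z. ennreal (gamma_dens n (q z)) * indicator I (q z) \<partial>lborel)"
    by (subst nn_integral_add) (auto simp: nn_integral_cmult L)
  also have "\<dots> \<le> ennreal c * ennreal L + ennreal M * ennreal (1 - exp (- s))"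
    using mass by (intro add_left_mono mult_left_mono) auto
  also have "\<dots> = ennreal (M * (1 - exp (- s))) + ennreal (L * c)"
    using c L0 M s by (simp add: ennreal_mult mult.commute add.commute)
  finally have "?X + ennreal (L * c) \<le> ennreal (M * (1 - exp (- s))) + ennreal (L * c)" .
  then show ?thesis
    by (simp add: q_def s_def ennreal_add_left_cancel_le add.commute[of _ "ennreal (L * c)"])
qed

subsection \<open>Radial averages of power series\<close>

definition gauss :: "complex \<Rightarrow> real" where
  "gauss z = exp (- pi * (cmod z)\<^sup>2)"

lemma borel_measurable_gauss [measurable]: "gauss \<in> borel_measurable borel"
  unfolding gauss_def by measurable

lemma gauss_nonneg [simp]: "0 \<le> gauss z"
  by (simp add: gauss_def)

lemma gauss_rotate: "cmod u = 1 \<Longrightarrow> gauss (u * z) = gauss z"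
  by (simp add: gauss_def norm_mult)

lemma gauss_monomial:
  "(cmod z) ^ (2 * n) * gauss z = fact n / pi ^ n * gamma_dens n (pi * (cmod z)\<^sup>2)"
  by (simp add: gauss_def gamma_dens_def power_mult_distrib power_mult[symmetric])

text \<open>The squared norm, with value infinity outside the Fock space instead of the default 0 of
  the Bochner integral.\<close>

definition fock_nn_norm :: "(complex \<Rightarrow> complex) \<Rightarrow> ennreal" where
  "fock_nn_norm f = (\<integral>\<^sup>+z. ennreal ((cmod (f z))\<^sup>2 * gauss z) \<partial>lborel)"

lemma entire_power_series:
  assumes "f holomorphic_on UNIV"
  obtains a where "\<And>z. (\<lambda>n. a n * z ^ n) sums f z"
proof
  show "(\<lambda>n. (deriv ^^ n) f 0 / fact n * z ^ n) sums f z" for z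
    using holomorphic_power_series[of f 0 "cmod z + 1" z] holomorphic_on_subset[OF assms] by simp
qed

lemma rotation_pair: "pair_sigma_finite unit_lborel (lborel :: complex measure)"
  by unfold_locales

context
  fixes a :: "nat \<Rightarrow> complex" and f :: "complex \<Rightarrow> complex"
  assumes ps: "\<And>z. (\<lambda>n. a n * z ^ n) sums f z"
begin

lemma power_series_entire: "f holomorphic_on UNIV"
proof -
  have "f holomorphic_on ball 0 r" for r
    by (rule power_series_holomorphic[where a = a]) (simp add: ps)
  then have "f field_differentiable (at z)" for z
    using holomorphic_on_imp_differentiable_at[of f "ball 0 (cmod z + 1)" z] by simp
  then show ?thesis
    by (simp add: holomorphic_on_def field_differentiable_at_within)
qed

lemma power_series_measurable: "f \<in> borel_measurable borel"
  using holomorphic_on_imp_continuous_on[OF power_series_entire]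
  by (rule borel_measurable_continuous_onI)

text \<open>Convergence at a point of larger modulus forces absolute convergence at z.\<close>

lemma power_series_abs_summable: "summable (\<lambda>n. cmod (a n * z ^ n))"
  by (rule powser_insidea[of a "of_real (cmod z + 1)"])
     (use ps in \<open>auto simp: sums_iff simp del: of_real_add\<close>)

lemma power_series_rotate: "f (u * z) = (\<Sum>n. a n * z ^ n * u ^ n)"
  using ps[of "u * z"] by (simp add: sums_iff power_mult_distrib mult_ac)

text \<open>Rotating f does not change its norm, so the norm may be averaged over all rotations.
  After Tonelli, Parseval on each circle removes the cross terms, and the Gamma normalisation
  evaluates the radial integrals.\<close>

lemma fock_parseval:
  "fock_nn_norm f = (\<Sum>n. ennreal ((cmod (a n))\<^sup>2 * fact n / pi ^ n))"
proof -
  interpret pair_sigma_finite unit_lborel "lborel :: complex measure"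
    by (rule rotation_pair)
  note power_series_measurable [measurable]
  have "fock_nn_norm f = (\<integral>\<^sup>+\<theta>. fock_nn_norm f \<partial>unit_lborel)"
    by (simp add: unit_lborel.emeasure_space_1[simplified])
  also have "\<dots> = (\<integral>\<^sup>+\<theta>. \<integral>\<^sup>+z. ennreal ((cmod (f (circ \<theta> * z)))\<^sup>2 * gauss z) \<partial>lborel \<partial>unit_lborel)"
  proof (rule nn_integral_cong)
    fix \<theta>
    show "fock_nn_norm f = (\<integral>\<^sup>+z. ennreal ((cmod (f (circ \<theta> * z)))\<^sup>2 * gauss z) \<partial>lborel)"
      using nn_integral_complex_rotate[of "\<lambda>z. ennreal ((cmod (f z))\<^sup>2 * gauss z)" "circ \<theta>"]
      by (simp add: fock_nn_norm_def gauss_rotate)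
  qed
  also have "\<dots> = (\<integral>\<^sup>+z. \<integral>\<^sup>+\<theta>. ennreal ((cmod (f (circ \<theta> * z)))\<^sup>2 * gauss z) \<partial>unit_lborel \<partial>lborel)"
    by (rule Fubini'[symmetric]) measurable
  also have "\<dots> = (\<integral>\<^sup>+z. (\<Sum>n. ennreal ((cmod (a n))\<^sup>2 * ((cmod z) ^ (2 * n) * gauss z))) \<partial>lborel)"
  proof (rule nn_integral_cong)
    fix z
    have "(\<integral>\<^sup>+\<theta>. ennreal ((cmod (f (circ \<theta> * z)))\<^sup>2 * gauss z) \<partial>unit_lborel)
        = (\<integral>\<^sup>+\<theta>. ennreal ((cmod (\<Sum>n. a n * z ^ n * circ \<theta> ^ n))\<^sup>2) \<partial>unit_lborel) * ennreal (gauss z)"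
      by (subst nn_integral_multc[symmetric])
         (auto simp: power_series_rotate ennreal_mult
           intro!: measurable_compose[OF circle_series_measurable[OF power_series_abs_summable]])
    also have "\<dots> = (\<Sum>n. ennreal ((cmod (a n * z ^ n))\<^sup>2)) * ennreal (gauss z)"
      by (subst circle_series_parseval[OF power_series_abs_summable]) simp
    also have "\<dots> = (\<Sum>n. ennreal ((cmod (a n))\<^sup>2 * ((cmod z) ^ (2 * n) * gauss z)))"
      by (subst ennreal_suminf_multc[symmetric])
         (simp add: norm_mult norm_power power_mult_distrib power_mult[symmetric]
           ennreal_mult'[symmetric] mult.assoc mult.commute[of _ 2])
    finally show "(\<integral>\<^sup>+\<theta>. ennreal ((cmod (f (circ \<theta> * z)))\<^sup>2 * gauss z) \<partial>unit_lborel)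
        = (\<Sum>n. ennreal ((cmod (a n))\<^sup>2 * ((cmod z) ^ (2 * n) * gauss z)))" .
  qed
  also have "\<dots> = (\<Sum>n. \<integral>\<^sup>+z. ennreal ((cmod (a n))\<^sup>2 * ((cmod z) ^ (2 * n) * gauss z)) \<partial>lborel)"
    by (rule nn_integral_suminf) measurable
  also have "\<dots> = (\<Sum>n. ennreal ((cmod (a n))\<^sup>2 * fact n / pi ^ n))"
  proof (rule arg_cong[where f = suminf], rule ext)
    fix n
    have "(\<integral>\<^sup>+z. ennreal ((cmod (a n))\<^sup>2 * ((cmod z) ^ (2 * n) * gauss z)) \<partial>lborel)
        = (\<integral>\<^sup>+z. ennreal ((cmod (a n))\<^sup>2 * fact n / pi ^ n)
            * ennreal (gamma_dens n (pi * (cmod z)\<^sup>2)) \<partial>lborel)"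
      by (simp add: gauss_monomial ennreal_mult'[symmetric] mult.assoc)
    also have "\<dots> = ennreal ((cmod (a n))\<^sup>2 * fact n / pi ^ n)"
      by (subst nn_integral_cmult) (auto simp: nn_integral_gamma_dens)
    finally show "(\<integral>\<^sup>+z. ennreal ((cmod (a n))\<^sup>2 * ((cmod z) ^ (2 * n) * gauss z)) \<partial>lborel)
        = ennreal ((cmod (a n))\<^sup>2 * fact n / pi ^ n)" .
  qed
  finally show ?thesis .
qed

context
  fixes F :: "complex \<Rightarrow> real"
  assumes F [measurable]: "F \<in> borel_measurable borel"
    and F_rotate: "\<And>u. cmod u = 1 \<Longrightarrow> AE z in lborel. F (u * z) = F z"
begin

text \<open>Tested against \<open>cnj w ^ n\<close>, a rotation invariant weight sees only the n-th
  Taylor coefficient: averaging over the circle kills all others.\<close>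

lemma rotation_average:
  assumes int: "integrable lborel (\<lambda>w. of_real (F w) * f w * cnj w ^ n * of_real (gauss w))"
  shows "(\<integral>w. of_real (F w) * f w * cnj w ^ n * of_real (gauss w) \<partial>lborel)
    = a n * (\<integral>w. of_real (F w * ((cmod w) ^ (2 * n) * gauss w)) \<partial>lborel)"
proof -
  interpret pair_sigma_finite unit_lborel "lborel :: complex measure"
    by (rule rotation_pair)
  note power_series_measurable [measurable]
  define k where "k w = of_real (F w) * f w * cnj w ^ n * of_real (gauss w)" for w
  \<comment> \<open>This is \<open>k (circ \<theta> * w)\<close> with the rotation dropped from
    \<open>F\<close> and \<open>gauss\<close>. For each angle the two agree for almost every w,
    which suffices while the w-integral is the inner one; after the exchange \<open>F w\<close> is a
    constant factor of the angular integral.\<close>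
  define H where "H \<theta> w = of_real (F w) * f (circ \<theta> * w) * cnj (circ \<theta> * w) ^ n * of_real (gauss w)"
    for \<theta> w
  have k_m [measurable]: "k \<in> borel_measurable borel"
    unfolding k_def by measurable
  have H_m [measurable]: "(\<lambda>p. H (fst p) (snd p)) \<in> borel_measurable (unit_lborel \<Otimes>\<^sub>M lborel)"
    unfolding H_def by measurable
  have H_m2 [measurable]: "H \<theta> \<in> borel_measurable borel" for \<theta>
    unfolding H_def by measurable
  have k_int: "integrable lborel k"
    using int by (simp add: k_def[abs_def])
  have kH: "AE w in lborel. k (circ \<theta> * w) = H \<theta> w" for \<theta>
    using F_rotate[OF norm_circ[of \<theta>]]
    by eventually_elim (simp add: k_def H_def gauss_rotate)
  have rot: "(\<integral>w. h (circ \<theta> * w) \<partial>lborel) = (\<integral>w. h w \<partial>lborel)"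
    if [measurable]: "h \<in> borel_measurable borel"
    for \<theta> and h :: "complex \<Rightarrow> 'b::{banach, second_countable_topology}"
    by (subst (2) lborel_distr_rotate[OF norm_circ[of \<theta>], symmetric], subst integral_distr) auto
  have Hint: "integrable lborel (H \<theta>)" for \<theta>
  proof -
    have "integrable (distr lborel borel (\<lambda>w. circ \<theta> * w)) k"
      using k_int by (simp add: lborel_distr_rotate)
    then have "integrable lborel (\<lambda>w. k (circ \<theta> * w))"
      by (subst (asm) integrable_distr_eq) auto
    then show ?thesis
      by (rule integrable_cong_AE_imp) (use kH[of \<theta>] in auto)
  qed
  have Hk: "(\<integral>w. H \<theta> w \<partial>lborel) = (\<integral>w. k w \<partial>lborel)" for \<theta>
    by (subst rot[OF k_m, of \<theta>, symmetric], rule integral_cong_AE) (use kH[of \<theta>] in auto)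
  \<comment> \<open>This value does not depend on the angle, so it is integrable over the circle, as
    Fubini requires.\<close>
  have Hnorm: "(\<integral>w. norm (H \<theta> w) \<partial>lborel) = (\<integral>w. norm (k w) \<partial>lborel)" for \<theta>
    by (subst rot[of "\<lambda>w. norm (k w)" \<theta>, symmetric], simp, rule integral_cong_AE)
       (use kH[of \<theta>] in \<open>auto elim!: eventually_mono\<close>)
  have Hpair: "integrable (unit_lborel \<Otimes>\<^sub>M lborel) (\<lambda>(\<theta>, w). H \<theta> w)"
    by (rule Fubini_integrable) (auto simp: Hnorm Hint case_prod_beta)
  have "(\<integral>w. k w \<partial>lborel) = (\<integral>\<theta>. (\<integral>w. H \<theta> w \<partial>lborel) \<partial>unit_lborel)"
    by (simp add: Hk unit_lborel.prob_space[simplified])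
  also have "\<dots> = (\<integral>w. (\<integral>\<theta>. H \<theta> w \<partial>unit_lborel) \<partial>lborel)"
    by (rule Fubini_integral[OF Hpair, symmetric])
  also have "\<dots> = (\<integral>w. a n * of_real (F w * ((cmod w) ^ (2 * n) * gauss w)) \<partial>lborel)"
  proof (rule Bochner_Integration.integral_cong[OF refl])
    fix w
    have "(\<integral>\<theta>. H \<theta> w \<partial>unit_lborel) = (\<integral>\<theta>. (of_real (F w * gauss w) * cnj w ^ n)
        * ((\<Sum>k. a k * w ^ k * circ \<theta> ^ k) * cnj (circ \<theta>) ^ n) \<partial>unit_lborel)"
      by (simp add: H_def power_series_rotate power_mult_distrib mult_ac)
    also have "\<dots> = of_real (F w * gauss w) * cnj w ^ n * (a n * w ^ n)"
      by (simp add: circle_series_coeff[OF power_series_abs_summable])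
    also have "\<dots> = a n * (of_real (F w * gauss w) * (w * cnj w) ^ n)"
      by (simp add: power_mult_distrib mult_ac)
    also have "\<dots> = a n * of_real (F w * ((cmod w) ^ (2 * n) * gauss w))"
      by (simp add: complex_norm_square[symmetric] power_mult[symmetric] mult_ac)
    finally show "(\<integral>\<theta>. H \<theta> w \<partial>unit_lborel) = a n * of_real (F w * ((cmod w) ^ (2 * n) * gauss w))" .
  qed
  finally show ?thesis by (simp add: k_def)
qed

end
end

subsection \<open>Toeplitz operators with symbols radial about 0\<close>

text \<open>The Toeplitz integral over Borel measure, with the Gaussian weight as an explicit
  factor, so that translations, rotations and product measures apply directly.\<close>

definition lborel_toeplitz :: "(complex \<Rightarrow> real) \<Rightarrow> (complex \<Rightarrow> complex) \<Rightarrow> complex \<Rightarrow> complex" where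
  "lborel_toeplitz F f z =
    (\<integral>w. of_real (F w) * f w * exp (of_real pi * cnj w * z) * of_real (gauss w) \<partial>lborel)"

text \<open>Provides the dominating function for expanding the kernel under the integral.\<close>

lemma norm_exp_partial_le:
  fixes x :: complex
  shows norm_exp_partial_sum_le: "cmod (\<Sum>i<N. x ^ i / fact i) \<le> exp (cmod x)"
    and norm_exp_term_le: "cmod (x ^ n / fact n) \<le> exp (cmod x)"
proof -
  have s: "(\<lambda>i. cmod x ^ i / fact i) sums exp (cmod x)"
    using exp_converges[of "cmod x"] by (simp add: divide_inverse mult.commute)
  have le: "(\<Sum>i\<in>I. cmod x ^ i / fact i) \<le> exp (cmod x)" if "finite I" for I
    using sum_le_suminf[OF sums_summable[OF s] that] s by (simp add: sums_iff)
  have "cmod (\<Sum>i<N. x ^ i / fact i) \<le> (\<Sum>i<N. cmod x ^ i / fact i)"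
    by (rule order_trans[OF norm_sum]) (simp add: norm_divide norm_power)
  then show "cmod (\<Sum>i<N. x ^ i / fact i) \<le> exp (cmod x)"
    using le[of "{..<N}"] by simp
  show "cmod (x ^ n / fact n) \<le> exp (cmod x)"
    using le[of "{n}"] by (simp add: norm_divide norm_power)
qed

lemma integrable_exp_gauss:
  "integrable lborel (\<lambda>w. exp (2 * pi * cmod w * r) * gauss w)"
proof (rule Bochner_Integration.integrable_bound)
  have "(\<integral>\<^sup>+w. ennreal (exp (- (pi * (cmod w)\<^sup>2) / 2)) \<partial>lborel)
      = (\<integral>\<^sup>+t. ennreal (exp (- t / 2)) * indicator {0..} t \<partial>lborel)"
    by (rule nn_integral_norm_square_complex[of "\<lambda>t. ennreal (exp (- t / 2))"]) measurable
  also have "\<dots> = ennreal (0 - - 2 * exp (- 0 / 2))"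
  proof (rule nn_integral_FTC_atLeast)
    show "((\<lambda>t. - 2 * exp (- t / 2)) has_real_derivative exp (- t / 2)) (at t)" for t :: real
      by (auto intro!: derivative_eq_intros)
    show "((\<lambda>t. - 2 * exp (- t / 2)) \<longlongrightarrow> (0::real)) at_top"
      by real_asymp
  qed auto
  finally have "integrable lborel (\<lambda>w. exp (- (pi * (cmod w)\<^sup>2) / 2))"
    by (intro integrableI_nonneg) auto
  then show "integrable lborel (\<lambda>w. exp (2 * pi * r\<^sup>2) * exp (- (pi * (cmod w)\<^sup>2) / 2))"
    by (rule integrable_mult_right)
  show "AE w in lborel. norm (exp (2 * pi * cmod w * r) * gauss w)
      \<le> norm (exp (2 * pi * r\<^sup>2) * exp (- (pi * (cmod w)\<^sup>2) / 2))"
  proof (rule AE_I2)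
    fix w :: complex
    \<comment> \<open>Completing the square absorbs the linear exponent at the price of half of the
      Gaussian.\<close>
    have "0 \<le> pi * (cmod w / 2 - r)\<^sup>2 * 2" by simp
    then have "2 * pi * cmod w * r + - pi * (cmod w)\<^sup>2 \<le> 2 * pi * r\<^sup>2 + - (pi * (cmod w)\<^sup>2) / 2"
      by (simp add: power2_eq_square algebra_simps)
    then show "norm (exp (2 * pi * cmod w * r) * gauss w)
      \<le> norm (exp (2 * pi * r\<^sup>2) * exp (- (pi * (cmod w)\<^sup>2) / 2))"
      by (simp add: gauss_def exp_add[symmetric])
  qed
qed measurable

context
  fixes a :: "nat \<Rightarrow> complex" and f :: "complex \<Rightarrow> complex" and F :: "complex \<Rightarrow> real"
    and M L :: real
  assumes ps: "\<And>z. (\<lambda>n. a n * z ^ n) sums f z"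
    and fin: "fock_nn_norm f < \<infinity>"
    and F [measurable]: "F \<in> borel_measurable borel"
    and F_rotate: "\<And>u. cmod u = 1 \<Longrightarrow> AE z in lborel. F (u * z) = F z"
    and bound: "AE z in lborel. \<bar>F z\<bar> \<le> M" and M: "0 < M"
    and L: "(\<integral>\<^sup>+z. ennreal \<bar>F z\<bar> \<partial>lborel) = ennreal L" and L0: "0 < L"
begin

text \<open>Both \<open>f\<close> and the kernel growth are square integrable for the Gaussian
  weight, and their product is at most the sum of their squares.\<close>

lemma toeplitz_integrand_integrable:
  "integrable lborel (\<lambda>w. \<bar>F w\<bar> * cmod (f w) * exp (pi * cmod w * r) * gauss w)"
proof (rule Bochner_Integration.integrable_bound)
  note power_series_measurable[OF ps, measurable]
  have "integrable lborel (\<lambda>w. (cmod (f w))\<^sup>2 * gauss w)"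
    using fin by (intro integrableI_nonneg) (auto simp: fock_nn_norm_def)
  then show "integrable lborel (\<lambda>w. M * ((cmod (f w))\<^sup>2 * gauss w + exp (2 * pi * cmod w * r) * gauss w))"
    by (intro integrable_mult_right Bochner_Integration.integrable_add integrable_exp_gauss)
  show "AE w in lborel. norm (\<bar>F w\<bar> * cmod (f w) * exp (pi * cmod w * r) * gauss w)
      \<le> norm (M * ((cmod (f w))\<^sup>2 * gauss w + exp (2 * pi * cmod w * r) * gauss w))"
    using bound
  proof eventually_elim
    case (elim w)
    define x y where "x = cmod (f w)" and "y = exp (pi * cmod w * r)"
    have y2: "exp (2 * pi * cmod w * r) = y\<^sup>2"
      by (simp add: y_def power2_eq_square exp_add[symmetric])
    have xy: "0 \<le> x" "0 \<le> y" by (simp_all add: x_def y_def)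
    have "0 \<le> (x - y)\<^sup>2" "0 \<le> x * y" using xy by auto
    then have "x * y \<le> x\<^sup>2 + y\<^sup>2" by (simp add: power2_eq_square algebra_simps)
    then have "\<bar>F w\<bar> * (x * y * gauss w) \<le> M * ((x\<^sup>2 + y\<^sup>2) * gauss w)"
      using elim M xy by (intro mult_mono mult_right_mono) auto
    then show ?case
      unfolding y2 x_def[symmetric] y_def[symmetric] using M xy
      by (simp add: abs_mult algebra_simps)
  qed
  show "(\<lambda>w. \<bar>F w\<bar> * cmod (f w) * exp (pi * cmod w * r) * gauss w) \<in> borel_measurable lborel"
    by measurable
qed

definition toeplitz_eigenvalue :: "nat \<Rightarrow> real" where
  "toeplitz_eigenvalue n = (\<integral>w. F w * gamma_dens n (pi * (cmod w)\<^sup>2) \<partial>lborel)"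

lemma toeplitz_eigenvalue_le: "\<bar>toeplitz_eigenvalue n\<bar> \<le> M * (1 - exp (- (L / M)))"
proof (cases "integrable lborel (\<lambda>w. F w * gamma_dens n (pi * (cmod w)\<^sup>2))")
  case True
  have "ennreal \<bar>toeplitz_eigenvalue n\<bar>
      \<le> (\<integral>\<^sup>+w. ennreal (norm (F w * gamma_dens n (pi * (cmod w)\<^sup>2))) \<partial>lborel)"
    using integral_norm_bound_ennreal[OF True] by (simp add: toeplitz_eigenvalue_def)
  also have "\<dots> = (\<integral>\<^sup>+w. ennreal (\<bar>F w\<bar> * gamma_dens n (pi * (cmod w)\<^sup>2)) \<partial>lborel)"
    by (simp add: abs_mult gamma_dens_nonneg)
  also have "\<dots> \<le> ennreal (M * (1 - exp (- (L / M))))"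
    by (rule nn_integral_gamma_dens_le[OF F bound M L L0])
  finally show ?thesis using M L0 by simp
next
  \<comment> \<open>The integral then defaults to 0, which respects the nonnegative bound.\<close>
  case False
  then show ?thesis
    using M L0 by (simp add: toeplitz_eigenvalue_def not_integrable_integral_eq)
qed

text \<open>Expand the kernel in powers of z and integrate termwise; \<open>rotation_average\<close>
  turns each term into a multiple of the matching Taylor term of f. Convergence at every z also
  makes the image entire.\<close>

lemma toeplitz_power_series:
  "(\<lambda>n. a n * of_real (toeplitz_eigenvalue n) * z ^ n) sums lborel_toeplitz F f z"
proof -
  note power_series_measurable[OF ps, measurable]
  define T where "T z n w = of_real (F w) * f w * ((of_real pi * cnj w * z) ^ n / fact n) * of_real (gauss w)"
    for z n w
  have [measurable]: "T z n \<in> borel_measurable borel" for z n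
    unfolding T_def by measurable
  have T_int: "integrable lborel (T z n)" for z n
  proof (rule Bochner_Integration.integrable_bound[OF toeplitz_integrand_integrable[of "cmod z"]])
    show "AE w in lborel. norm (T z n w) \<le> norm (\<bar>F w\<bar> * cmod (f w) * exp (pi * cmod w * cmod z) * gauss w)"
    proof (rule AE_I2)
      fix w
      have "cmod ((of_real pi * cnj w * z) ^ n / fact n) \<le> exp (pi * cmod w * cmod z)"
        using norm_exp_term_le[of "of_real pi * cnj w * z" n] by (simp add: norm_mult)
      then have "\<bar>F w\<bar> * cmod (f w) * cmod ((of_real pi * cnj w * z) ^ n / fact n) * gauss w
          \<le> \<bar>F w\<bar> * cmod (f w) * exp (pi * cmod w * cmod z) * gauss w"
        by (intro mult_right_mono mult_left_mono) auto
      then show "norm (T z n w)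
          \<le> norm (\<bar>F w\<bar> * cmod (f w) * exp (pi * cmod w * cmod z) * gauss w)"
        by (simp only: T_def norm_mult norm_of_real real_norm_def abs_mult abs_abs abs_norm_cancel
            abs_exp_cancel abs_of_nonneg[OF gauss_nonneg])
    qed
  qed simp
  have T_eq: "(\<integral>w. T z n w \<partial>lborel) = a n * of_real (toeplitz_eigenvalue n) * z ^ n" for n
  proof -
    define k where "k w = of_real (F w) * f w * cnj w ^ n * of_real (gauss w)" for w
    \<comment> \<open>Taking the term at the point 1 avoids a division by \<open>z ^ n\<close>,
      which may vanish.\<close>
    have "k = (\<lambda>w. of_real (fact n / pi ^ n) * T 1 n w)"
      by (simp add: fun_eq_iff k_def T_def power_mult_distrib)
    then have k_int: "integrable lborel k"
      by (simp only: integrable_mult_right[OF T_int])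
    have "(\<integral>w. T z n w \<partial>lborel) = (\<integral>w. of_real (pi ^ n / fact n) * z ^ n * k w \<partial>lborel)"
      by (rule Bochner_Integration.integral_cong) (simp_all add: T_def k_def power_mult_distrib)
    also have "\<dots> = of_real (pi ^ n / fact n) * z ^ n * (\<integral>w. k w \<partial>lborel)"
      by (rule integral_mult_right_zero)
    also have "(\<integral>w. k w \<partial>lborel) = a n * (\<integral>w. of_real (F w * ((cmod w) ^ (2 * n) * gauss w)) \<partial>lborel)"
      unfolding k_def
      by (rule rotation_average[OF ps F F_rotate]) (use k_int in \<open>auto simp: k_def[abs_def]\<close>)
    also have "(\<integral>w. of_real (F w * ((cmod w) ^ (2 * n) * gauss w)) \<partial>lborel)
        = (of_real (\<integral>w. F w * ((cmod w) ^ (2 * n) * gauss w) \<partial>lborel) :: complex)"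
      by (rule integral_complex_of_real)
    also have "(\<integral>w. F w * ((cmod w) ^ (2 * n) * gauss w) \<partial>lborel)
        = (\<integral>w. fact n / pi ^ n * (F w * gamma_dens n (pi * (cmod w)\<^sup>2)) \<partial>lborel)"
      by (rule Bochner_Integration.integral_cong) (simp_all add: gauss_monomial)
    also have "\<dots> = fact n / pi ^ n * toeplitz_eigenvalue n"
      unfolding toeplitz_eigenvalue_def by (rule integral_mult_right_zero)
    finally show ?thesis by simp
  qed
  have "(\<lambda>N. \<integral>w. (\<Sum>n<N. T z n w) \<partial>lborel) \<longlonglongrightarrow> lborel_toeplitz F f z"
    unfolding lborel_toeplitz_def
  proof (rule integral_dominated_convergence)
    show "integrable lborel (\<lambda>w. \<bar>F w\<bar> * cmod (f w) * exp (pi * cmod w * cmod z) * gauss w)"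
      by (rule toeplitz_integrand_integrable)
    have T_sum: "(\<Sum>n<N. T z n w)
        = of_real (F w) * f w * (\<Sum>n<N. (of_real pi * cnj w * z) ^ n / fact n) * of_real (gauss w)" for N w
      by (simp add: T_def sum_distrib_left sum_distrib_right)
    show "AE w in lborel. (\<lambda>N. \<Sum>n<N. T z n w)
        \<longlonglongrightarrow> of_real (F w) * f w * exp (of_real pi * cnj w * z) * of_real (gauss w)"
    proof (rule AE_I2)
      fix w
      have "(\<lambda>n. (of_real pi * cnj w * z) ^ n / fact n) sums exp (of_real pi * cnj w * z)"
        using exp_converges[of "of_real pi * cnj w * z"]
        by (simp add: scaleR_conv_of_real divide_inverse mult.commute)
      then show "(\<lambda>N. \<Sum>n<N. T z n w)
          \<longlonglongrightarrow> of_real (F w) * f w * exp (of_real pi * cnj w * z) * of_real (gauss w)"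
        unfolding T_sum sums_def by (intro tendsto_intros)
    qed
    show "AE w in lborel. norm (\<Sum>n<N. T z n w)
        \<le> \<bar>F w\<bar> * cmod (f w) * exp (pi * cmod w * cmod z) * gauss w" for N
    proof (intro AE_I2)
      fix w
      have "cmod (\<Sum>n<N. (of_real pi * cnj w * z) ^ n / fact n) \<le> exp (pi * cmod w * cmod z)"
        using norm_exp_partial_sum_le[of "of_real pi * cnj w * z" N] by (simp add: norm_mult)
      then show "norm (\<Sum>n<N. T z n w) \<le> \<bar>F w\<bar> * cmod (f w) * exp (pi * cmod w * cmod z) * gauss w"
        unfolding T_sum norm_mult by (auto intro!: mult_right_mono mult_left_mono)
    qed
  qed measurable
  then show ?thesis
    unfolding sums_def by (simp add: T_int T_eq)
qed

text \<open>Parseval on both sides reduces the bound to the uniform bound on the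
  eigenvalues.\<close>

lemma toeplitz_nn_norm_le:
  "fock_nn_norm (lborel_toeplitz F f) \<le> ennreal ((M * (1 - exp (- (L / M))))\<^sup>2) * fock_nn_norm f"
proof -
  define C where "C = M * (1 - exp (- (L / M)))"
  have "fock_nn_norm (lborel_toeplitz F f)
      = (\<Sum>n. ennreal ((cmod (a n * of_real (toeplitz_eigenvalue n)))\<^sup>2 * fact n / pi ^ n))"
    by (rule fock_parseval[OF toeplitz_power_series])
  also have "\<dots> \<le> (\<Sum>n. ennreal (C\<^sup>2) * ennreal ((cmod (a n))\<^sup>2 * fact n / pi ^ n))"
  proof (intro suminf_le summableI)
    fix n
    have "(toeplitz_eigenvalue n)\<^sup>2 \<le> C\<^sup>2"
      using toeplitz_eigenvalue_le[of n] abs_le_square_iff[of "toeplitz_eigenvalue n" C]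
      by (simp add: C_def)
    then have "(toeplitz_eigenvalue n)\<^sup>2 * ((cmod (a n))\<^sup>2 * fact n / pi ^ n)
        \<le> C\<^sup>2 * ((cmod (a n))\<^sup>2 * fact n / pi ^ n)"
      by (rule mult_right_mono) simp
    then show "ennreal ((cmod (a n * of_real (toeplitz_eigenvalue n)))\<^sup>2 * fact n / pi ^ n)
        \<le> ennreal (C\<^sup>2) * ennreal ((cmod (a n))\<^sup>2 * fact n / pi ^ n)"
      by (simp add: ennreal_mult'[symmetric] norm_mult power_mult_distrib mult_ac ennreal_leI)
  qed
  also have "\<dots> = ennreal (C\<^sup>2) * fock_nn_norm f"
    by (simp add: fock_parseval[OF ps])
  finally show ?thesis by (simp add: C_def)
qed

end

subsection \<open>Weyl operators\<close>

lemma AE_lborel_translate: "AE z in lborel. P z \<Longrightarrow> AE z in lborel. P (z + c)"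
  for c :: "'a::euclidean_space"
proof -
  assume "AE z in lborel. P z"
  then have "AE z in distr lborel borel ((+) c). P z"
    by (subst lborel_distr_plus)
  then have "AE z in lborel. P (c + z)"
    by (rule AE_distrD[rotated]) simp
  then show ?thesis by (simp add: add.commute)
qed

lemma nn_integral_lborel_translate:
  fixes h :: "'a::euclidean_space \<Rightarrow> ennreal"
  assumes "h \<in> borel_measurable borel"
  shows "(\<integral>\<^sup>+z. h (z + c) \<partial>lborel) = (\<integral>\<^sup>+z. h z \<partial>lborel)"
  using assms by (subst (2) lborel_distr_plus[of c, symmetric], subst nn_integral_distr)
    (auto simp: add.commute)

lemma integral_lborel_translate:
  fixes h :: "'a::euclidean_space \<Rightarrow> 'b::{banach, second_countable_topology}"
  assumes "h \<in> borel_measurable borel"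
  shows "(\<integral>z. h (z + c) \<partial>lborel) = (\<integral>z. h z \<partial>lborel)"
  using assms by (subst (2) lborel_distr_plus[of c, symmetric], subst integral_distr)
    (auto simp: add.commute)

text \<open>Translation alone does not preserve the Gaussian weight. The exponential, which is the
  normalised reproducing kernel at -a, is an entire factor whose modulus compensates
  exactly.\<close>

definition weyl :: "complex \<Rightarrow> (complex \<Rightarrow> complex) \<Rightarrow> complex \<Rightarrow> complex" where
  "weyl a f z = f (z + a) * exp (- (of_real pi * cnj a * z) - of_real (pi * (cmod a)\<^sup>2 / 2))"

lemma norm_weyl_sq: "(cmod (weyl a f z))\<^sup>2 * gauss z = (cmod (f (z + a)))\<^sup>2 * gauss (z + a)"
proof -
  have "(cmod (z + a))\<^sup>2 = (cmod z)\<^sup>2 + (cmod a)\<^sup>2 + 2 * Re (cnj a * z)"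
    by (simp only: cmod_power2 plus_complex.sel) (simp add: power2_eq_square algebra_simps)
  then have "2 * (- (pi * Re (cnj a * z)) - pi * (cmod a)\<^sup>2 / 2) + - pi * (cmod z)\<^sup>2
      = - pi * (cmod (z + a))\<^sup>2"
    by (simp add: algebra_simps)
  moreover have "(cmod (exp (- (of_real pi * cnj a * z) - of_real (pi * (cmod a)\<^sup>2 / 2))))\<^sup>2
      = exp (2 * (- (pi * Re (cnj a * z)) - pi * (cmod a)\<^sup>2 / 2))"
    by (simp add: norm_exp_eq_Re exp_double[symmetric] mult.assoc del: Re_divide_of_nat)
  ultimately show ?thesis
    by (simp only: weyl_def norm_mult power_mult_distrib mult.assoc gauss_def exp_add[symmetric])
qed

lemma fock_nn_norm_weyl:
  assumes "f \<in> borel_measurable borel"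
  shows "fock_nn_norm (weyl a f) = fock_nn_norm f"
  using nn_integral_lborel_translate[of "\<lambda>z. ennreal ((cmod (f z))\<^sup>2 * gauss z)" a] assms
  by (simp add: fock_nn_norm_def norm_weyl_sq)

lemma weyl_holomorphic: "f holomorphic_on UNIV \<Longrightarrow> weyl a f holomorphic_on UNIV"
  unfolding weyl_def
  by (intro holomorphic_intros holomorphic_on_compose_gen[of "\<lambda>z. z + a" UNIV f UNIV, unfolded o_def]) auto

lemma weyl_inverse: "f z = weyl a f (z - a) * exp (of_real pi * cnj a * (z - a) + of_real (pi * (cmod a)\<^sup>2 / 2))"
  by (simp add: weyl_def mult.assoc exp_add[symmetric])

text \<open>Substituting w + a for w, the exponents of kernel, Gaussian and Weyl factor at z
  recombine into those of kernel, Gaussian and Weyl factor at w.\<close>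

lemma weyl_toeplitz:
  assumes [measurable]: "F \<in> borel_measurable borel" "f \<in> borel_measurable borel"
  shows "weyl a (lborel_toeplitz F f) = lborel_toeplitz (\<lambda>w. F (w + a)) (weyl a f)"
proof
  fix z
  define c where "c = exp (- (of_real pi * cnj a * z) - of_real (pi * (cmod a)\<^sup>2 / 2))"
  define h where "h w = of_real (F w) * f w * exp (of_real pi * cnj w * (z + a)) * of_real (gauss w)" for w
  have [measurable]: "h \<in> borel_measurable borel" unfolding h_def by measurable
  have "weyl a (lborel_toeplitz F f) z = (\<integral>w. h w \<partial>lborel) * c"
    by (simp add: weyl_def lborel_toeplitz_def h_def c_def)
  also have "\<dots> = (\<integral>w. h (w + a) * c \<partial>lborel)"
    by (simp add: integral_lborel_translate)
  also have "\<dots> = lborel_toeplitz (\<lambda>w. F (w + a)) (weyl a f) z"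
    unfolding lborel_toeplitz_def
  proof (rule Bochner_Integration.integral_cong[OF refl])
    fix w
    have g: "of_real (gauss v) = exp (- of_real pi * (v * cnj v))" for v
      by (simp add: gauss_def exp_of_real[symmetric] complex_norm_square[symmetric] del: exp_of_real)
    have "exp (of_real pi * cnj (w + a) * (z + a)) * of_real (gauss (w + a)) * c
      = exp (- (of_real pi * cnj a * w) - of_real (pi * (cmod a)\<^sup>2 / 2))
        * exp (of_real pi * cnj w * z) * of_real (gauss w)"
      unfolding g c_def exp_add[symmetric] of_real_mult of_real_divide complex_norm_square
      by (rule arg_cong[of _ _ exp]) (simp add: field_simps)
    then have "of_real (F (w + a)) * f (w + a) * (exp (of_real pi * cnj (w + a) * (z + a)) * of_real (gauss (w + a)) * c)
      = of_real (F (w + a)) * f (w + a) * (exp (- (of_real pi * cnj a * w) - of_real (pi * (cmod a)\<^sup>2 / 2))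
        * exp (of_real pi * cnj w * z) * of_real (gauss w))"
      by (rule arg_cong)
    then show "h (w + a) * c = of_real (F (w + a)) * weyl a f w * exp (of_real pi * cnj w * z) * of_real (gauss w)"
      unfolding h_def weyl_def by (simp only: mult.assoc)
  qed
  finally show "weyl a (lborel_toeplitz F f) z = lborel_toeplitz (\<lambda>w. F (w + a)) (weyl a f) z" .
qed

section \<open>Passage from the Gaussian measure to Borel integrals\<close>

lemma integrable_gaussian_measure:
  fixes f :: "complex \<Rightarrow> 'b::{banach, second_countable_topology}"
  assumes [measurable]: "f \<in> borel_measurable borel"
  shows "integrable gaussian_measure f \<longleftrightarrow> integrable lborel (\<lambda>z. gauss z *\<^sub>R f z)"
    and "integral\<^sup>L gaussian_measure f = (\<integral>z. gauss z *\<^sub>R f z \<partial>lborel)"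
proof -
  have m: "gauss \<in> borel_measurable lebesgue" "f \<in> borel_measurable lebesgue"
    by (simp_all add: measurable_completion)
  have m2: "(\<lambda>z. gauss z *\<^sub>R f z) \<in> borel_measurable lborel" by measurable
  have G: "gaussian_measure = density lebesgue (\<lambda>z. ennreal (gauss z))"
    by (simp add: gaussian_measure_def gauss_def)
  \<comment> \<open>For Borel integrands, completing the measure changes neither integrability nor
    the integral.\<close>
  show "integrable gaussian_measure f \<longleftrightarrow> integrable lborel (\<lambda>z. gauss z *\<^sub>R f z)"
    unfolding G by (subst integrable_density) (use m m2 in \<open>auto simp: integrable_completion\<close>)
  show "integral\<^sup>L gaussian_measure f = (\<integral>z. gauss z *\<^sub>R f z \<partial>lborel)"
    unfolding G by (subst integral_density) (use m m2 in \<open>auto simp: integral_completion\<close>)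
qed

lemma entire_measurable:
  fixes f :: "complex \<Rightarrow> complex"
  shows "f holomorphic_on UNIV \<Longrightarrow> f \<in> borel_measurable borel"
  by (intro borel_measurable_continuous_onI holomorphic_on_imp_continuous_on)

lemma fock_space_iff: "f \<in> fock_space \<longleftrightarrow> f holomorphic_on UNIV \<and> fock_nn_norm f < \<infinity>"
proof (cases "f holomorphic_on UNIV")
  case True
  note [measurable] = entire_measurable[OF True]
  have "integrable gaussian_measure (\<lambda>z. (cmod (f z))\<^sup>2)
      \<longleftrightarrow> integrable lborel (\<lambda>z. (cmod (f z))\<^sup>2 * gauss z)"
    by (subst integrable_gaussian_measure) (auto simp: mult.commute)
  also have "\<dots> \<longleftrightarrow> fock_nn_norm f < \<infinity>"
    by (subst integrable_iff_bounded) (simp add: fock_nn_norm_def)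
  finally show ?thesis using True by (simp add: fock_space_def)
qed (simp add: fock_space_def)

lemma fock_norm_eq:
  assumes "f holomorphic_on UNIV"
  shows "fock_norm f = sqrt (enn2real (fock_nn_norm f))"
proof -
  note [measurable] = entire_measurable[OF assms]
  have "(LINT z|gaussian_measure. (cmod (f z))\<^sup>2) = (\<integral>z. (cmod (f z))\<^sup>2 * gauss z \<partial>lborel)"
    by (subst integrable_gaussian_measure) (auto simp: mult.commute)
  also have "\<dots> = enn2real (fock_nn_norm f)"
    unfolding fock_nn_norm_def by (rule integral_eq_nn_integral) auto
  finally show ?thesis by (simp add: fock_norm_def)
qed

text \<open>Changing the symbol on a null set leaves the integral unchanged for each z, so the
  images agree at every point and not merely almost everywhere.\<close>

lemma toeplitz_eq_lborel_toeplitz: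
  assumes [measurable]: "F \<in> borel_measurable lebesgue" "F' \<in> borel_measurable borel"
    "f \<in> borel_measurable borel" and eq: "AE z in lebesgue. F z = F' z"
  shows "toeplitz (\<lambda>z. of_real (F z)) f = lborel_toeplitz F' f"
proof
  fix z
  have [measurable]: "f \<in> borel_measurable lebesgue" "(\<lambda>w. fock_kernel w z) \<in> borel_measurable lebesgue"
    "F' \<in> borel_measurable lebesgue"
    by (simp_all add: measurable_completion fock_kernel_def)
  have "toeplitz (\<lambda>z. of_real (F z)) f z
      = (LINT w|gaussian_measure. of_real (F' w) * f w * fock_kernel w z)"
    unfolding toeplitz_def
  proof (rule integral_cong_AE)
    show "AE w in gaussian_measure. of_real (F w) * f w * fock_kernel w z = of_real (F' w) * f w * fock_kernel w z"
      unfolding gaussian_measure_def using eq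
      by (subst AE_density) (auto simp: measurable_completion elim!: eventually_mono)
  qed (simp_all add: gaussian_measure_def)
  also have "\<dots> = lborel_toeplitz F' f z"
    by (subst integrable_gaussian_measure)
       (auto simp: lborel_toeplitz_def fock_kernel_def scaleR_conv_of_real mult_ac)
  finally show "toeplitz (\<lambda>z. of_real (F z)) f z = lborel_toeplitz F' f z" .
qed

section \<open>Symbols radial about an arbitrary point\<close>

lemma lborel_toeplitz_bounded:
  fixes F :: "complex \<Rightarrow> real"
  assumes F [measurable]: "F \<in> borel_measurable borel"
    and radial: "AE z in lborel. F z = g (cmod (z - a))"
    and bound: "AE z in lborel. \<bar>F z\<bar> \<le> M" and M: "0 < M"
    and L: "(\<integral>\<^sup>+z. ennreal \<bar>F z\<bar> \<partial>lborel) = ennreal L" and L0: "0 < L"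
    and f: "f holomorphic_on UNIV" "fock_nn_norm f < \<infinity>"
  shows "lborel_toeplitz F f holomorphic_on UNIV"
    and "fock_nn_norm (lborel_toeplitz F f) \<le> ennreal ((M * (1 - exp (- (L / M))))\<^sup>2) * fock_nn_norm f"
proof -
  note [measurable] = entire_measurable[OF f(1)]
  define Fa where "Fa w = F (w + a)" for w
  have Fa [measurable]: "Fa \<in> borel_measurable borel" unfolding Fa_def by measurable
  have Fa_g: "AE w in lborel. Fa w = g (cmod w)"
    using AE_lborel_translate[OF radial, of a] by (simp add: Fa_def)
  have rot: "AE w in lborel. Fa (u * w) = Fa w" if "cmod u = 1" for u
  proof -
    have "AE w in distr lborel borel ((*) u). Fa w = g (cmod w)"
      using Fa_g by (subst lborel_distr_rotate[OF that])
    then have "AE w in lborel. Fa (u * w) = g (cmod (u * w))"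
      by (rule AE_distrD[rotated]) simp
    with Fa_g show ?thesis
      by eventually_elim (simp add: norm_mult that)
  qed
  have Fa_bound: "AE w in lborel. \<bar>Fa w\<bar> \<le> M"
    using AE_lborel_translate[OF bound, of a] by (simp add: Fa_def)
  have Fa_L: "(\<integral>\<^sup>+w. ennreal \<bar>Fa w\<bar> \<partial>lborel) = ennreal L"
    using nn_integral_lborel_translate[of "\<lambda>z. ennreal \<bar>F z\<bar>" a] by (simp add: Fa_def L)
  obtain b where ps: "\<And>z. (\<lambda>n. b n * z ^ n) sums weyl a f z"
    using entire_power_series[OF weyl_holomorphic[OF f(1)]] by blast
  have fin: "fock_nn_norm (weyl a f) < \<infinity>" using f by (simp add: fock_nn_norm_weyl)
  have W: "weyl a (lborel_toeplitz F f) = lborel_toeplitz Fa (weyl a f)"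
    unfolding Fa_def by (rule weyl_toeplitz) measurable
  have holW: "lborel_toeplitz Fa (weyl a f) holomorphic_on UNIV"
    by (rule power_series_entire[OF toeplitz_power_series[OF ps fin Fa rot Fa_bound M Fa_L L0]])
  \<comment> \<open>Holomorphy is carried back by undoing the Weyl operator, whose exponential
    factor never vanishes.\<close>
  have "(\<lambda>z. lborel_toeplitz Fa (weyl a f) (z - a)
      * exp (of_real pi * cnj a * (z - a) + of_real (pi * (cmod a)\<^sup>2 / 2))) holomorphic_on UNIV"
    by (intro holomorphic_intros holomorphic_on_compose_gen[OF _ holW, of "\<lambda>z. z - a", unfolded o_def]) auto
  then show hol: "lborel_toeplitz F f holomorphic_on UNIV"
    by (rule holomorphic_transform) (simp add: weyl_inverse[of "lborel_toeplitz F f" _ a] W)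
  \<comment> \<open>Holomorphy of the image supplies the measurability under which the Weyl operator
    preserves its norm.\<close>
  show "fock_nn_norm (lborel_toeplitz F f) \<le> ennreal ((M * (1 - exp (- (L / M))))\<^sup>2) * fock_nn_norm f"
    using toeplitz_nn_norm_le[OF ps fin Fa rot Fa_bound M Fa_L L0]
      fock_nn_norm_weyl[OF entire_measurable[OF hol], of a]
    by (simp add: W fock_nn_norm_weyl)
qed

theorem theorem1:
  fixes F :: "complex \<Rightarrow> real" and a :: complex
  assumes L1: "integrable lebesgue F"
    and Linf: "esssup lebesgue (\<lambda>z. ennreal \<bar>F z\<bar>) < \<infinity>"
    and nonzero: "\<not> (AE z in lebesgue. F z = 0)"
    and radial: "radial_about a F"
  shows "toeplitz (\<lambda>z. of_real (F z)) \<in> fock_space \<rightarrow> fock_space \<and>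
    fock_op_norm (toeplitz (\<lambda>z. of_real (F z)))
      \<le> ennreal (Linf_norm F * (1 - exp (- (L1_norm F / Linf_norm F))))"
proof -
  define M where "M = Linf_norm F"
  define L where "L = L1_norm F"
  define C where "C = M * (1 - exp (- (L / M)))"
  have F_m: "F \<in> borel_measurable lebesgue" using L1 by simp
  \<comment> \<open>Finiteness of the essential supremum ensures that \<open>enn2real\<close> loses
    nothing.\<close>
  have esssup_M: "esssup lebesgue (\<lambda>z. ennreal \<bar>F z\<bar>) = ennreal M"
    using Linf by (simp add: M_def Linf_norm_def)
  have M_nonneg: "0 \<le> M" by (simp add: M_def Linf_norm_def)
  have bound: "AE z in lebesgue. \<bar>F z\<bar> \<le> M"
    using esssup_AE[where f = "\<lambda>z. ennreal \<bar>F z\<bar>" and M = lebesgue]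
  proof eventually_elim
    case (elim z)
    then show ?case by (simp add: esssup_M M_nonneg)
  qed
  \<comment> \<open>Otherwise the bound would force \<open>F\<close> to vanish almost everywhere;
    the quotient L / M is thus genuine.\<close>
  have "M \<noteq> 0" using bound nonzero by auto
  then have M0: "0 < M" using M_nonneg by simp
  have "L \<noteq> 0"
    using nonzero L1 integral_nonneg_eq_0_iff_AE[of lebesgue "\<lambda>z. \<bar>F z\<bar>"]
    by (auto simp: L_def L1_norm_def)
  moreover have "0 \<le> L" by (simp add: L_def L1_norm_def)
  ultimately have L0: "0 < L" by simp
  have C0: "0 \<le> C" using M0 L0 by (simp add: C_def)
  obtain F' where F' [measurable]: "F' \<in> borel_measurable borel" and "AE z in lborel. F z = F' z"
    using completion_ex_borel_measurable_real[OF F_m] by auto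
  then have eq: "AE z in lebesgue. F z = F' z"
    by (auto intro: AE_completion)
  obtain g where "AE z in lebesgue. F z = g (cmod (z - a))"
    using radial by (auto simp: radial_about_def)
  with eq have "AE z in lebesgue. F' z = g (cmod (z - a))"
    by eventually_elim simp
  then have radial': "AE z in lborel. F' z = g (cmod (z - a))"
    by (simp add: AE_completion_iff)
  from eq bound have "AE z in lebesgue. \<bar>F' z\<bar> \<le> M"
    by eventually_elim simp
  then have bound': "AE z in lborel. \<bar>F' z\<bar> \<le> M"
    by (simp add: AE_completion_iff)
  have "(\<integral>\<^sup>+z. ennreal \<bar>F' z\<bar> \<partial>lborel) = (\<integral>\<^sup>+z. ennreal \<bar>F' z\<bar> \<partial>lebesgue)"
    by (simp add: nn_integral_completion)
  also have "\<dots> = (\<integral>\<^sup>+z. ennreal \<bar>F z\<bar> \<partial>lebesgue)"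
    by (rule nn_integral_cong_AE) (use eq in \<open>auto elim!: eventually_mono\<close>)
  also have "\<dots> = ennreal L"
    unfolding L_def L1_norm_def by (rule nn_integral_eq_integral) (use L1 in auto)
  finally have L': "(\<integral>\<^sup>+z. ennreal \<bar>F' z\<bar> \<partial>lborel) = ennreal L" .
  let ?T = "toeplitz (\<lambda>z. of_real (F z))"
  have T: "?T f holomorphic_on UNIV" "fock_nn_norm (?T f) \<le> ennreal (C\<^sup>2) * fock_nn_norm f"
    if "f \<in> fock_space" for f
    using that lborel_toeplitz_bounded[OF F' radial' bound' M0 L' L0, of f]
      toeplitz_eq_lborel_toeplitz[OF F_m F' _ eq, of f] entire_measurable[of f]
    by (auto simp: fock_space_iff C_def)
  have T_fock: "?T f \<in> fock_space" if "f \<in> fock_space" for f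
    using T[OF that] that unfolding fock_space_iff
    by (auto intro: le_less_trans simp: ennreal_mult_less_top)
  have T_norm: "fock_norm (?T f) \<le> C" if f: "f \<in> fock_space" "fock_norm f \<le> 1" for f
  proof -
    have fin: "fock_nn_norm f < \<infinity>" and hol: "f holomorphic_on UNIV"
      using f(1) by (auto simp: fock_space_iff)
    \<comment> \<open>\<open>enn2real\<close> sends infinity to 0, so monotonicity needs the
      right-hand side to be finite.\<close>
    have "enn2real (fock_nn_norm (?T f)) \<le> enn2real (ennreal (C\<^sup>2) * fock_nn_norm f)"
      using T(2)[OF f(1)] fin by (intro enn2real_mono) (auto simp: ennreal_mult_less_top)
    also have "\<dots> = C\<^sup>2 * enn2real (fock_nn_norm f)"
      by (simp add: enn2real_mult)
    also have "\<dots> \<le> C\<^sup>2 * 1"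
      using f(2) hol by (intro mult_left_mono) (auto simp: fock_norm_eq)
    finally have "sqrt (enn2real (fock_nn_norm (?T f))) \<le> C"
      using C0 by (intro real_le_lsqrt) auto
    then show ?thesis by (simp only: fock_norm_eq[OF T(1)[OF f(1)]])
  qed
  show ?thesis
    unfolding M_def[symmetric] L_def[symmetric] C_def[symmetric] fock_op_norm_def
    using T_fock T_norm by (auto intro!: SUP_least ennreal_leI)
qed

end
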